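(* Let $m,n\ge1$ be integers and $1\le r<\infty$. Let $T$ be an $m$-linear singular integral operator associated with a kernel $K(x,y_1,\ldots,y_m)$ such that $T$ is bounded from $L^{r}(\mathbb{R}^n)\times \cdots \times L^r(\mathbb{R}^n)$ ($m$ factors) to $L^{r/m,\infty}(\mathbb{R}^n)$ and $K$ satisfies the $m$-linear $L^{r}$-Hörmander condition $K_r<\infty$. Then there is a constant $c_{n,r}$, depending only on $n,r$ (and on the fixed number $m$), such that for all compactly supported functions $f_i\in L^r(\mathbb{R}^n)$, $i=1,\ldots, m$, there exists a sparse family $\mathcal S$ of cubes such that for a.e. $x\in \mathbb{R}^n$, $$|T(f_1,\ldots, f_m)(x)|\le c_{n,r}\big(\|T\|_{L^r\times\cdots\times L^r\rightarrow L^{r/m,\infty}}+ K_{r}\big)\sum_{Q\in \mathcal S}\prod_{i=1}^m\Big( \frac1{|Q|}\int_Q |f_i|^r\Big)^{\frac 1r}\chi_Q(x).$$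
   Context: Cubes in $\mathbb{R}^n$ have sides parallel to the coordinate axes; for a cube $Q$ and $\lambda>0$, $\lambda Q$ is the cube with the same center and side length $\lambda\,\ell(Q)$; $Q^m=Q\times\cdots\times Q$ ($m$ times); $\chi_E$ is the indicator function of $E$; $r'=r/(r-1)$ is the conjugate exponent ($r'=\infty$ if $r=1$). Associated kernel: $K$ is a measurable function defined off the diagonal $x=y_1=\cdots=y_m$ of $(\mathbb{R}^n)^{m+1}$. An $m$-linear operator $T$ is a singular integral operator associated with $K$ if, for all compactly supported $f_i\in L^r(\mathbb{R}^n)$, $$T(f_1,\ldots,f_m)(x)=\int_{(\mathbb{R}^n)^m}K(x,y_1,\ldots,y_m)\prod_{i=1}^m f_i(y_i)\,d\vec y\quad\text{for a.e. }x\notin\bigcap_{i=1}^m\operatorname{supp}f_i,$$ with absolutely convergent integral. $m$-linear $L^r$-Hörmander condition: for $1<r<\infty$, $$K_r:=\sup_Q \sup_{x,z\in \frac 12 Q}\sum_{k=1}^{\infty}|2^k Q|^{\frac m r}\Big(\int_{(2^{k}Q )^m\setminus (2^{k-1} Q)^m}|K(x,y_1,\ldots,y_m)-K(z,y_1,\ldots,y_m)|^{r'}d {\vec y}\Big)^{\frac 1{r'}}<\infty,$$ and for $r=1$, $$K_1:=\sup_Q \sup_{x,z\in \frac 12 Q}\sum_{k=1}^{\infty}|2^k Q|^{m}\operatorname*{ess\,sup}_{\vec y\in (2^{k}Q )^m\setminus (2^{k-1} Q)^m} |K(x,y_1,\ldots,y_m)-K(z,y_1,\ldots,y_m)|<\infty,$$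 where $Q$ ranges over all cubes in $\mathbb{R}^n$. Sparse family: a family $\mathcal S$ of cubes is sparse if there is $\gamma\in(0,1)$ such that for every $Q\in\mathcal S$ there is a measurable set $E_Q\subset Q$ with $|E_Q|\ge\gamma|Q|$, and the sets $\{E_Q\}_{Q\in\mathcal S}$ are pairwise disjoint. Weak spaces: $\|g\|_{L^{s,\infty}}=\sup_{\lambda>0}\lambda\,|\{x:|g(x)|>\lambda\}|^{1/s}$ for $0<s<\infty$. $\|T\|_{L^r\times\cdots\times L^r\to L^{r/m,\infty}}$ is the least $C$ with $\|T(f_1,\ldots,f_m)\|_{L^{r/m,\infty}}\le C\prod_{i=1}^m\|f_i\|_{L^r}$ for all $f_i\in L^r(\mathbb{R}^n)$. *)

theory Defs
  imports "HOL-Analysis.Analysis" "HOL-Probability.Essential_Supremum"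
begin

text \<open>
  The space \<open>\<real>\<^sup>n\<close> is \<open>real ^ 'n\<close>, and \<open>(\<real>\<^sup>n)\<^sup>m\<close> is \<open>real ^ 'n ^ 'm\<close>, so that \<open>y $ i\<close> is the
  variable \<open>y\<^sub>i\<close> and \<open>n, m \<ge> 1\<close> hold because types are nonempty.
  The scalars \<open>'a\<close> of class \<open>{real_normed_field, banach, second_countable_topology}\<close> cover
  real-valued as well as complex-valued functions. An \<open>m\<close>-tuple of functions is a map
  \<open>'m \<Rightarrow> real ^ 'n \<Rightarrow> 'a\<close>. Quantities in \<open>[0, \<infinity>]\<close> have type \<open>ennreal\<close>.
\<close>

text \<open>Powers of elements of \<open>[0, \<infinity>]\<close>, only meant for exponents \<open>p > 0\<close>.\<close>

definition ennpowr :: "ennreal \<Rightarrow> real \<Rightarrow> ennreal" where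
  "ennpowr a p = (if a = \<infinity> then \<infinity> else ennreal (enn2real a powr p))"

definition Lspace :: "real \<Rightarrow> ((real ^ 'n) \<Rightarrow> 'a::{real_normed_field, banach, second_countable_topology}) set" where
  "Lspace r = {f \<in> borel_measurable lebesgue. integrable lebesgue (\<lambda>x. norm (f x) powr r)}"

definition Lnorm :: "real \<Rightarrow> ((real ^ 'n) \<Rightarrow> 'a::{real_normed_field, banach, second_countable_topology}) \<Rightarrow> real" where
  "Lnorm r f = (\<integral>x. norm (f x) powr r \<partial>lebesgue) powr (1 / r)"

definition weak_norm :: "real \<Rightarrow> ((real ^ 'n) \<Rightarrow> 'a::{real_normed_field, banach, second_countable_topology}) \<Rightarrow> ennreal" where
  "weak_norm s g =
    (SUP t\<in>{0<..}. ennreal t * ennpowr (emeasure lebesgue {x. norm (g x) > t}) (1 / s))"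

text \<open>
  The support of a function defined up to null sets: the complement of the largest open set on
  which it vanishes almost everywhere.
\<close>

definition ess_supp :: "((real ^ 'n) \<Rightarrow> 'a::{real_normed_field, banach, second_countable_topology}) \<Rightarrow> (real ^ 'n) set" where
  "ess_supp f = - \<Union>{U. open U \<and> (AE x in lebesgue. x \<in> U \<longrightarrow> f x = 0)}"

text \<open>
  Cubes are taken closed; the dilate \<open>\<lambda>Q\<close> of \<open>Q = cube c l\<close> is \<open>cube c (\<lambda> * l)\<close>.
\<close>

definition cube :: "real ^ 'n \<Rightarrow> real \<Rightarrow> (real ^ 'n) set" where
  "cube c l = {x. \<forall>j. \<bar>x $ j - c $ j\<bar> \<le> l / 2}"

definition is_cube :: "(real ^ 'n) set \<Rightarrow> bool" where
  "is_cube Q \<longleftrightarrow> (\<exists>c l. 0 < l \<and> Q = cube c l)"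

definition set_pow :: "(real ^ 'n) set \<Rightarrow> (real ^ 'n ^ 'm) set" where
  "set_pow Q = {y. \<forall>i. y $ i \<in> Q}"

definition sparse_family :: "(real ^ 'n) set set \<Rightarrow> bool" where
  "sparse_family S \<longleftrightarrow>
    (\<forall>Q\<in>S. is_cube Q) \<and>
    (\<exists>\<gamma> E. 0 < \<gamma> \<and> \<gamma> < 1 \<and>
      (\<forall>Q\<in>S. E Q \<in> sets lebesgue \<and> E Q \<subseteq> Q \<and> measure lebesgue (E Q) \<ge> \<gamma> * measure lebesgue Q) \<and>
      disjoint_family_on E S)"

text \<open>
  An \<open>m\<close>-linear operator on \<open>L\<^sup>r \<times> \<dots> \<times> L\<^sup>r\<close> with values in the measurable functions. It acts on
  representatives, so it has to be compatible with equality almost everywhere, and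
  \<open>m\<close>-linearity is an identity almost everywhere.
\<close>

definition multilinear_operator ::
  "real \<Rightarrow> (('m::finite \<Rightarrow> real ^ 'n \<Rightarrow> 'a::{real_normed_field, banach, second_countable_topology})
    \<Rightarrow> real ^ 'n \<Rightarrow> 'a) \<Rightarrow> bool" where
  "multilinear_operator r T \<longleftrightarrow>
    (\<forall>f. (\<forall>i. f i \<in> Lspace r) \<longrightarrow> T f \<in> borel_measurable lebesgue) \<and>
    (\<forall>f g. (\<forall>i. f i \<in> Lspace r \<and> g i \<in> Lspace r \<and> (AE x in lebesgue. f i x = g i x)) \<longrightarrow>
      (AE x in lebesgue. T f x = T g x)) \<and>
    (\<forall>f j u v. (\<forall>i. f i \<in> Lspace r) \<longrightarrow> u \<in> Lspace r \<longrightarrow> v \<in> Lspace r \<longrightarrow>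
      (AE x in lebesgue. T (f(j := \<lambda>y. u y + v y)) x = T (f(j := u)) x + T (f(j := v)) x)) \<and>
    (\<forall>f j u a. (\<forall>i. f i \<in> Lspace r) \<longrightarrow> u \<in> Lspace r \<longrightarrow>
      (AE x in lebesgue. T (f(j := \<lambda>y. a * u y)) x = a * T (f(j := u)) x))"

text \<open>The value of the kernel on the diagonal \<open>x = y\<^sub>1 = \<dots> = y\<^sub>m\<close> is irrelevant.\<close>

definition singular_kernel ::
  "(real ^ 'n \<Rightarrow> real ^ 'n ^ 'm \<Rightarrow> 'a::{real_normed_field, banach, second_countable_topology}) \<Rightarrow> bool" where
  "singular_kernel K \<longleftrightarrow>
    (\<lambda>(x, y). K x y) \<in> borel_measurable (lebesgue_on {(x, y). \<not> (\<forall>i. y $ i = x)})"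

definition singular_integral_operator ::
  "real \<Rightarrow> (('m::finite \<Rightarrow> real ^ 'n \<Rightarrow> 'a::{real_normed_field, banach, second_countable_topology})
    \<Rightarrow> real ^ 'n \<Rightarrow> 'a) \<Rightarrow> (real ^ 'n \<Rightarrow> real ^ 'n ^ 'm \<Rightarrow> 'a) \<Rightarrow> bool" where
  "singular_integral_operator r T K \<longleftrightarrow>
    multilinear_operator r T \<and> singular_kernel K \<and>
    (\<forall>f. (\<forall>i. f i \<in> Lspace r \<and> compact (ess_supp (f i))) \<longrightarrow>
      (AE x in lebesgue. x \<notin> (\<Inter>i. ess_supp (f i)) \<longrightarrow>
        integrable lebesgue (\<lambda>y. K x y * (\<Prod>i\<in>UNIV. f i (y $ i))) \<and>
        T f x = (\<integral>y. K x y * (\<Prod>i\<in>UNIV. f i (y $ i)) \<partial>lebesgue)))"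

text \<open>
  The least constant \<open>C \<in> [0, \<infinity>]\<close> in the bound from \<open>L\<^sup>r \<times> \<dots> \<times> L\<^sup>r\<close> to \<open>L\<^bsup>r/m,\<infinity>\<^esup>\<close>; the operator
  is bounded iff it is finite.
\<close>

definition weak_op_norm ::
  "real \<Rightarrow> (('m::finite \<Rightarrow> real ^ 'n \<Rightarrow> 'a::{real_normed_field, banach, second_countable_topology})
    \<Rightarrow> real ^ 'n \<Rightarrow> 'a) \<Rightarrow> ennreal" where
  "weak_op_norm r T =
    Inf {C. \<forall>f. (\<forall>i. f i \<in> Lspace r) \<longrightarrow>
      weak_norm (r / real CARD('m)) (T f) \<le> C * ennreal (\<Prod>i\<in>UNIV. Lnorm r (f i))}"

definition annulus :: "nat \<Rightarrow> real ^ 'n \<Rightarrow> real \<Rightarrow> (real ^ 'n ^ 'm) set" where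
  "annulus k c l = set_pow (cube c (2 ^ k * l)) - set_pow (cube c (2 ^ (k - 1) * l))"

text \<open>The \<open>L\<^bsup>r'\<^esup>\<close> norm over \<open>A\<close> with \<open>r' = r / (r - 1)\<close>, where \<open>r' = \<infinity>\<close> if \<open>r = 1\<close>.\<close>

definition dual_norm_on ::
  "real \<Rightarrow> (real ^ 'n ^ 'm) set \<Rightarrow> (real ^ 'n ^ 'm \<Rightarrow> 'a::{real_normed_field, banach, second_countable_topology})
    \<Rightarrow> ennreal" where
  "dual_norm_on r A g =
    (if r = 1 then esssup (lebesgue_on A) (\<lambda>y. ennreal (norm (g y)))
     else let r' = r / (r - 1) in
       ennpowr (\<integral>\<^sup>+y\<in>A. ennreal (norm (g y) powr r') \<partial>lebesgue) (1 / r'))"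

definition hormander_const ::
  "real \<Rightarrow> (real ^ 'n \<Rightarrow> real ^ 'n ^ 'm \<Rightarrow> 'a::{real_normed_field, banach, second_countable_topology})
    \<Rightarrow> ennreal" where
  "hormander_const r K =
    (SUP (c, l) \<in> UNIV \<times> {0<..}. SUP (x, z) \<in> cube c (l / 2) \<times> cube c (l / 2).
      \<Sum>\<^sub>\<infinity>k\<in>{1..}. ennreal (measure lebesgue (cube c (2 ^ k * l)) powr (real CARD('m) / r)) *
        dual_norm_on r (annulus k c l) (\<lambda>y. K x y - K z y))"

text \<open>
  The sum over \<open>Q \<in> S\<close> takes values in \<open>[0, \<infinity>]\<close>, where every family is summable.
\<close>

definition sparse_form ::
  "real \<Rightarrow> (real ^ 'n) set set
    \<Rightarrow> ('m::finite \<Rightarrow> real ^ 'n \<Rightarrow> 'a::{real_normed_field, banach, second_countable_topology})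
    \<Rightarrow> real ^ 'n \<Rightarrow> ennreal" where
  "sparse_form r S f x =
    (\<Sum>\<^sub>\<infinity>Q\<in>S. ennreal ((\<Prod>i\<in>UNIV.
        (1 / measure lebesgue Q * (LINT y:Q|lebesgue. norm (f i y) powr r)) powr (1 / r))
      * indicator Q x))"

end

theory Submission
  imports Defs
begin

text \<open>
  The proof selects the sparse family by a stopping time on dyadic cells. For a cell \<open>Q\<close> let \<open>f\<^sub>Q\<close> denote
  the tuple of the functions \<open>f\<^sub>i\<close> truncated to the fivefold dilate \<open>5Q\<close>, and let \<open>D\<^sub>Q\<close> be the
  product of their \<open>L\<^sup>r\<close> averages over \<open>5Q\<close>. The central estimate (lemma \<open>sparse_step\<close>) provides disjoint
  cells \<open>P \<subseteq> Q\<close> that cover at most half of \<open>Q\<close> such that, almost everywhere on \<open>Q\<close>,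
  \<open>|T f\<^sub>Q| \<le> c (\<parallel>T\<parallel> + K\<^sub>r) D\<^sub>Q\<close> outside these cells and
  \<open>|T f\<^sub>Q| \<le> c (\<parallel>T\<parallel> + K\<^sub>r) D\<^sub>Q + |T f\<^sub>P|\<close> on \<open>P\<close>. Iteration (lemma \<open>sparse_domination_of_step\<close>) yields the
  sparse bound for \<open>T f\<^sub>Q\<close>, with the dilates \<open>5P\<close> of all selected cells as the sparse family. Finally the space
  is partitioned into root cells \<open>Q\<close> for which \<open>5Q\<close> contains the supports (lemma \<open>root_cells\<close>), and on each of
  them \<open>T f = T f\<^sub>Q\<close>.

  For the central estimate, consider the exceptional set of points where \<open>|T f\<^sub>Q|\<close> is larger than a big multiple of
  \<open>\<parallel>T\<parallel> D\<^sub>Q\<close>, or where some average of \<open>|f\<^sub>i|\<^sup>r\<close> over a dilated dyadic cell around the point is larger than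
  a big multiple of the average over \<open>5Q\<close>. The weak type bound for \<open>T\<close> (lemma \<open>local_weak_type\<close>) and the weak type
  bound for a dyadic maximal function (lemma \<open>emeasure_high_avg\<close>) make this set small compared with \<open>Q\<close>, and the
  cells \<open>P\<close> form the Calderon-Zygmund decomposition of a slight enlargement of it (lemma \<open>stopping_cells\<close>). For \<open>x \<in> P\<close>, the difference
  \<open>T f\<^sub>Q - T f\<^sub>P\<close> is an integral of \<open>K(x, y)\<close> over \<open>y \<in> (5Q)\<^sup>m - (5P)\<^sup>m\<close>, because each of its multilinear
  components has an entry that vanishes near \<open>x\<close> (lemma \<open>kernel_difference\<close>). Replacing \<open>x\<close> by another point
  \<open>z \<in> P\<close> changes this integral by at most \<open>K\<^sub>r\<close> times averages of the functions over the dilates \<open>2\<^sup>kP\<close>: this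
  is Hoelder's inequality on the annuli of the Hoermander condition (lemma \<open>kernel_oscillation\<close>). Every
  stopping cell contains a point \<open>z\<close> outside the exceptional set at which \<open>T f\<^sub>P\<close> is also controlled by the weak
  type bound; there all averages are comparable to those over \<open>5Q\<close>, and the estimate follows.
\<close>

section \<open>Dyadic cells and their dilates\<close>

text \<open>
  All measures are taken with respect to \<^const>\<open>lebesgue\<close>; the simplifier should not replace it by
  \<^const>\<open>lborel\<close> for Borel sets.
\<close>

declare emeasure_completion [simp del] measure_completion [simp del]

text \<open>
  A dyadic cell is indexed by a pair \<open>(k, v)\<close>: it has side \<open>2\<^sup>k\<close> and lower corner \<open>2\<^sup>k v\<close>. Membership is
  stated through floors, so cells are half-open, the cells of one level partition the space, and the
  passage to larger cells is integer division of \<open>v\<close> by powers of two.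
\<close>

definition side :: "int \<times> (int ^ 'n) \<Rightarrow> real" where
  "side q = 2 powi (fst q)"

definition cell :: "int \<times> (int ^ 'n) \<Rightarrow> (real ^ 'n) set" where
  "cell q = {x. \<forall>j. \<lfloor>x $ j / side q\<rfloor> = snd q $ j}"

definition center :: "int \<times> (int ^ 'n) \<Rightarrow> real ^ 'n" where
  "center q = (\<chi> j. side q * (real_of_int (snd q $ j) + 1 / 2))"

definition dilate :: "real \<Rightarrow> int \<times> (int ^ 'n) \<Rightarrow> (real ^ 'n) set" where
  "dilate a q = cube (center q) (a * side q)"

definition ancestor :: "nat \<Rightarrow> int \<times> (int ^ 'n) \<Rightarrow> int \<times> (int ^ 'n)" where
  "ancestor i q = (fst q + int i, \<chi> j. snd q $ j div 2 ^ i)"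

definition cell_at :: "int \<Rightarrow> real ^ 'n \<Rightarrow> int \<times> (int ^ 'n)" where
  "cell_at k x = (k, \<chi> j. \<lfloor>x $ j / 2 powi k\<rfloor>)"

lemma side_pos [simp]: "side q > 0"
  by (simp add: side_def)

lemma side_nonneg [simp]: "side q \<ge> 0"
  by (simp add: side_def)

lemma side_neq_0 [simp]: "side q \<noteq> 0"
  by (simp add: side_def)

lemma side_ancestor: "side (ancestor i q) = 2 ^ i * side q"
  by (simp add: side_def ancestor_def power_int_add)

lemma side_mono: "fst p \<le> fst q \<Longrightarrow> side p \<le> side q"
  by (simp add: side_def power_int_increasing)

lemma fst_cell_at [simp]: "fst (cell_at k x) = k"
  by (simp add: cell_at_def)

lemma fst_ancestor [simp]: "fst (ancestor i q) = fst q + int i"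
  by (simp add: ancestor_def)

lemma mem_cell_iff: "x \<in> cell q \<longleftrightarrow> q = cell_at (fst q) x"
  by (auto simp: cell_def cell_at_def side_def prod_eq_iff vec_eq_iff)

lemma mem_cell_at [simp]: "x \<in> cell (cell_at k x)"
  by (simp add: mem_cell_iff)

lemma ancestor_cell_at: "ancestor i (cell_at k x) = cell_at (k + int i) x"
proof -
  have "\<lfloor>x $ j / 2 powi k\<rfloor> div 2 ^ i = \<lfloor>x $ j / 2 powi (k + int i)\<rfloor>" for j
    using floor_divide_real_eq_div[of "2 ^ i" "x $ j / 2 powi k"]
    by (simp add: power_int_add)
  then show ?thesis by (simp add: ancestor_def cell_at_def)
qed

lemma ancestor_0 [simp]: "ancestor 0 q = q"
  by (simp add: ancestor_def)

lemma cell_subset_ancestor: "cell q \<subseteq> cell (ancestor i q)"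
proof
  fix x assume "x \<in> cell q"
  then have "q = cell_at (fst q) x" by (simp add: mem_cell_iff)
  then have "ancestor i q = cell_at (fst q + int i) x" by (metis ancestor_cell_at)
  then show "x \<in> cell (ancestor i q)" by simp
qed

text \<open>
  Cells are nested or disjoint: a common point already determines the larger cell from the
  smaller one.
\<close>

lemma cell_common_ancestor:
  assumes "x \<in> cell p" "x \<in> cell q" "fst p \<le> fst q"
  shows "q = ancestor (nat (fst q - fst p)) p"
proof -
  have "p = cell_at (fst p) x" "q = cell_at (fst q) x" using assms by (simp_all add: mem_cell_iff)
  then have "ancestor (nat (fst q - fst p)) p = cell_at (fst p + int (nat (fst q - fst p))) x"
    by (metis ancestor_cell_at)
  with assms \<open>q = _\<close> show ?thesis by simp
qed

lemma ancestor_ancestor: "ancestor i (ancestor j q) = ancestor (i + j) q"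
proof -
  have "v div 2 ^ j div 2 ^ i = v div 2 ^ (i + j)" for v :: int
    by (simp add: power_add mult.commute[of "2 ^ i"] zdiv_zmult2_eq)
  then show ?thesis by (simp add: ancestor_def add.commute)
qed

lemma mem_cell_bounds:
  "x \<in> cell q \<longleftrightarrow> (\<forall>j. side q * snd q $ j \<le> x $ j \<and> x $ j < side q * (snd q $ j + 1))"
proof -
  have "(\<lfloor>t / side q\<rfloor> = v) = (side q * v \<le> t \<and> t < side q * (v + 1))" for t and v :: int
    using side_pos[of q] by (auto simp: floor_eq_iff field_simps)
  then show ?thesis by (simp add: cell_def)
qed

lemma cube_eq_cbox: "cube c l = cbox (\<chi> j. c $ j - l / 2) (\<chi> j. c $ j + l / 2)"
proof -
  have "\<bar>t - u\<bar> \<le> l / 2 \<longleftrightarrow> u - l / 2 \<le> t \<and> t \<le> u + l / 2" for t u :: real by linarith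
  then show ?thesis by (auto simp: cube_def mem_box_cart)
qed

lemma closed_cube [simp]: "closed (cube c l)"
  unfolding cube_eq_cbox by (rule closed_cbox)

lemma compact_cube [simp]: "compact (cube c l)"
  unfolding cube_eq_cbox by (rule compact_cbox)

lemma borel_cube [measurable, simp]: "cube c l \<in> sets borel"
  by (simp add: borel_closed)

lemma lebesgue_cube [simp]: "cube c l \<in> sets lebesgue"
  by (simp add: cube_eq_cbox)

lemma emeasure_equal_sided_box:
  fixes a b :: "real ^ 'n"
  assumes "\<And>j. b $ j - a $ j = l" "l \<ge> 0"
  shows "emeasure lebesgue (cbox a b) = ennreal (l ^ CARD('n))"
    and "emeasure lebesgue (box a b) = ennreal (l ^ CARD('n))"
proof -
  have le: "a $ j \<le> b $ j" for j using assms(1)[of j] assms(2) by simp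
  have "cbox a b \<noteq> {}" using le by (simp add: interval_ne_empty_cart)
  then have c: "measure lebesgue (cbox a b) = l ^ CARD('n)"
    using content_cbox_cart[of a b] by (simp add: assms measure_completion)
  have f: "emeasure lebesgue (cbox a b) \<noteq> \<infinity>"
    by (simp add: emeasure_completion emeasure_lborel_cbox_eq)
  show e: "emeasure lebesgue (cbox a b) = ennreal (l ^ CARD('n))"
    using emeasure_eq_ennreal_measure[of lebesgue "cbox a b"] c f by simp
  then show "emeasure lebesgue (box a b) = ennreal (l ^ CARD('n))"
    by (simp add: emeasure_completion emeasure_lborel_cbox_eq emeasure_lborel_box_eq)
qed

lemma emeasure_cube: "l \<ge> 0 \<Longrightarrow> emeasure lebesgue (cube c l :: (real ^ 'n) set) = ennreal (l ^ CARD('n))"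
  unfolding cube_eq_cbox by (rule emeasure_equal_sided_box) auto

lemma measure_cube: "l \<ge> 0 \<Longrightarrow> measure lebesgue (cube c l :: (real ^ 'n) set) = l ^ CARD('n)"
  by (simp add: measure_def emeasure_cube)

lemma borel_cell [measurable, simp]: "cell q \<in> sets borel"
proof -
  have "cell q = (\<Inter>j. {x. side q * snd q $ j \<le> x $ j} \<inter> {x. x $ j < side q * (snd q $ j + 1)})"
    by (auto simp: mem_cell_bounds)
  also have "\<dots> \<in> sets borel" by (intro sets.finite_INT) auto
  finally show ?thesis .
qed

lemma lebesgue_cell [simp]: "cell q \<in> sets lebesgue"
  by (simp add: sets_completionI_sets)

lemma emeasure_cell: "emeasure lebesgue (cell (q :: int \<times> (int ^ 'n))) = ennreal (side q ^ CARD('n))"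
proof -
  let ?a = "\<chi> j. side q * snd q $ j :: real ^ 'n" and ?b = "\<chi> j. side q * (snd q $ j + 1) :: real ^ 'n"
  have 1: "box ?a ?b \<subseteq> cell q" "cell q \<subseteq> cbox ?a ?b"
    by (auto simp: mem_cell_bounds mem_box_cart less_imp_le)
  have 2: "?b $ j - ?a $ j = side q" for j by (simp add: algebra_simps)
  note e = emeasure_equal_sided_box[of ?b ?a, OF 2]
  show ?thesis
  proof (rule antisym)
    show "emeasure lebesgue (cell q) \<le> ennreal (side q ^ CARD('n))"
      using emeasure_mono[OF 1(2), of lebesgue] unfolding e(1)[OF side_nonneg] by simp
    show "ennreal (side q ^ CARD('n)) \<le> emeasure lebesgue (cell q)"
      using emeasure_mono[OF 1(1), of lebesgue] unfolding e(2)[OF side_nonneg] by simp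
  qed
qed

lemma center_mem_cell: "center q \<in> cell q"
  by (auto simp: mem_cell_bounds center_def algebra_simps)

lemma mem_cell_center: "x \<in> cell q \<Longrightarrow> \<bar>x $ j - center q $ j\<bar> \<le> side q / 2"
  proof -
  assume "x \<in> cell q"
  then have "side q * snd q $ j \<le> x $ j" "x $ j < side q * (snd q $ j + 1)"
    by (simp_all only: mem_cell_bounds)
  then show ?thesis by (simp add: center_def abs_le_iff field_simps)
qed

lemma mem_dilate: "x \<in> dilate a q \<longleftrightarrow> (\<forall>j. \<bar>x $ j - center q $ j\<bar> \<le> a * side q / 2)"
  by (simp add: dilate_def cube_def)

lemma closed_dilate [simp]: "closed (dilate a q)" and compact_dilate [simp]: "compact (dilate a q)"
  and borel_dilate [measurable, simp]: "dilate a q \<in> sets borel"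
  and lebesgue_dilate [simp]: "dilate a q \<in> sets lebesgue"
  by (simp_all add: dilate_def)

lemma emeasure_dilate:
  "a \<ge> 0 \<Longrightarrow> emeasure lebesgue (dilate a (q :: int \<times> (int ^ 'n))) = ennreal ((a * side q) ^ CARD('n))"
  by (simp add: dilate_def emeasure_cube)

lemma measure_dilate:
  "a \<ge> 0 \<Longrightarrow> measure lebesgue (dilate a (q :: int \<times> (int ^ 'n))) = (a * side q) ^ CARD('n)"
  by (simp add: dilate_def measure_cube)

lemma cell_subset_dilate:
  assumes "1 \<le> a" shows "cell q \<subseteq> dilate a q"
proof
  fix x assume x: "x \<in> cell q"
  have "1 * side q \<le> a * side q" using assms by (intro mult_right_mono) auto
  show "x \<in> dilate a q" unfolding mem_dilate
  proof
    fix j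
    have "\<bar>x $ j - center q $ j\<bar> \<le> side q / 2" by (rule mem_cell_center[OF x])
    then show "\<bar>x $ j - center q $ j\<bar> \<le> a * side q / 2"
      using \<open>1 * side q \<le> a * side q\<close> by linarith
  qed
qed

text \<open>
  A cell lies inside its ancestor, so in each coordinate the centers are at most half the
  difference of the side lengths apart. This controls every inclusion between dilates below.
\<close>

lemma center_ancestor:
  "\<bar>center q $ j - center (ancestor i q) $ j\<bar> \<le> (side (ancestor i q) - side q) / 2"
proof -
  let ?v = "snd q $ j" and ?w = "snd q $ j div 2 ^ i"
  have m: "?v = 2 ^ i * ?w + ?v mod 2 ^ i" by simp
  have b: "0 \<le> ?v mod 2 ^ i" "?v mod 2 ^ i < 2 ^ i" by simp_all
  define u where "u = ?v mod 2 ^ i"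
  have "u \<le> 2 ^ i - 1" using b by (simp add: u_def)
  then have "real_of_int u \<le> real_of_int (2 ^ i - 1)" by (simp only: of_int_le_iff)
  then have u1: "0 \<le> real_of_int u" "real_of_int u \<le> 2 ^ i - 1" using b by (simp_all add: u_def)
  have "real_of_int ?v = real_of_int (2 ^ i * ?w + u)" using m unfolding u_def by (simp only:)
  then have v: "real_of_int ?v = 2 ^ i * real_of_int ?w + real_of_int u" by simp
  have "center q $ j - center (ancestor i q) $ j = side q * (real_of_int u + 1/2 - 2 ^ i / 2)"
    unfolding center_def side_ancestor by (simp add: ancestor_def v algebra_simps)
  moreover have "\<bar>real_of_int u + 1/2 - 2 ^ i / 2\<bar> \<le> (2 ^ i - 1) / 2" using u1
    unfolding abs_le_iff by (auto simp: field_simps)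
  then have "side q * \<bar>real_of_int u + 1/2 - 2 ^ i / 2\<bar> \<le> side q * ((2 ^ i - 1) / 2)"
    by (intro mult_left_mono) auto
  ultimately have "\<bar>center q $ j - center (ancestor i q) $ j\<bar> \<le> side q * ((2 ^ i - 1) / 2)"
    by (simp only: abs_mult) simp
  also have "\<dots> = (side (ancestor i q) - side q) / 2" by (simp add: side_ancestor algebra_simps)
  finally show ?thesis .
qed

lemma dilate_subset_dilate_ancestor:
  assumes "b * side p + (side (ancestor i p) - side p) \<le> a * side (ancestor i p)"
  shows "dilate b p \<subseteq> dilate a (ancestor i p)"
proof
  fix x assume x: "x \<in> dilate b p"
  show "x \<in> dilate a (ancestor i p)" unfolding mem_dilate
  proof
    fix j
    show "\<bar>x $ j - center (ancestor i p) $ j\<bar> \<le> a * side (ancestor i p) / 2"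
      using x[unfolded mem_dilate, rule_format, of j] center_ancestor[of p j i] assms
        abs_triangle_ineq[of "x $ j - center p $ j" "center p $ j - center (ancestor i p) $ j"]
      by (simp add: field_simps)
  qed
qed

lemma dilate_mono_ancestor:
  assumes "1 \<le> a" shows "dilate a p \<subseteq> dilate a (ancestor i p)"
proof (rule dilate_subset_dilate_ancestor)
  have "side p \<le> side (ancestor i p)" by (rule side_mono) simp
  then have "0 \<le> (a - 1) * (side (ancestor i p) - side p)" using assms by simp
  then show "a * side p + (side (ancestor i p) - side p) \<le> a * side (ancestor i p)"
    by (simp add: algebra_simps)
qed

lemma cell_subsetD:
  assumes "cell p \<subseteq> cell q" shows "fst p \<le> fst q" 
proof -
  have "ennreal (side p ^ CARD('a)) \<le> ennreal (side q ^ CARD('a))"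
    using emeasure_mono[OF assms, of lebesgue] by (simp add: emeasure_cell)
  then have "side p ^ CARD('a) \<le> side q ^ CARD('a)" by (simp add: ennreal_le_iff)
  then have "side p \<le> side q" by (simp add: power_mono_iff)
  moreover have "side q < side p" if "fst q < fst p"
    unfolding side_def using that by (intro power_int_strict_increasing) auto
  ultimately show ?thesis by fastforce
qed

lemma cell_subset_obtains:
  assumes "cell p \<subseteq> cell q" obtains i where "q = ancestor i p"
  using cell_common_ancestor[of "center p" p q] center_mem_cell assms cell_subsetD by blast

lemma cell_subset_dilate_mono:
  assumes "cell p \<subseteq> cell q" "1 \<le> a" shows "dilate a p \<subseteq> dilate a q"
  by (metis assms cell_subset_obtains dilate_mono_ancestor)

lemma cell_nested:
  assumes "x \<in> cell p" "x \<in> cell q" "fst p \<le> fst q"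
  shows "cell p \<subseteq> cell q"
  using cell_common_ancestor[OF assms] cell_subset_ancestor by metis

lemma small_cell_in_open:
  fixes x :: "real ^ 'n"
  assumes "open G" "x \<in> G"
  obtains k where "k \<le> k0" "cell (cell_at k x) \<subseteq> G"
proof -
  obtain e where e: "e > 0" "ball x e \<subseteq> G" using assms open_contains_ball by blast
  define d where "d = e / (real CARD('n) + 1)"
  have d: "d > 0" using e by (simp add: d_def add_pos_pos)
  obtain N where N: "(1 / 2) ^ N < d" using d real_arch_pow_inv[of d "1/2"] by auto
  define k where "k = min k0 (- int N)"
  have "2 powi k \<le> (2 :: real) powi (- int N)" by (intro power_int_increasing) (auto simp: k_def)
  also have "\<dots> = (1 / 2) ^ N" by (simp add: power_int_minus power_one_over inverse_eq_divide)
  finally have s: "2 powi k < d" using N by linarith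
  have "cell (cell_at k x) \<subseteq> ball x e"
  proof
    fix y assume y: "y \<in> cell (cell_at k x)"
    have c: "\<bar>(x - y) $ j\<bar> \<le> d" for j
    proof -
      have "\<bar>y $ j - center (cell_at k x) $ j\<bar> \<le> 2 powi k / 2"
        "\<bar>x $ j - center (cell_at k x) $ j\<bar> \<le> 2 powi k / 2"
        using mem_cell_center[OF y, of j] mem_cell_center[OF mem_cell_at[of x k], of j]
        by (simp_all add: side_def)
      then show ?thesis unfolding vector_minus_component abs_le_iff using s by linarith
    qed
    have "norm (x - y) \<le> (\<Sum>j\<in>UNIV. \<bar>(x - y) $ j\<bar>)" by (rule norm_le_l1_cart)
    also have "\<dots> \<le> real CARD('n) * d" using sum_bounded_above[of UNIV "\<lambda>j. \<bar>(x - y) $ j\<bar>" d] c by simp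
    also have "\<dots> < e"
    proof -
      have "(real CARD('n) + 1) * d = e" by (simp add: d_def)
      then show ?thesis using d by (simp add: algebra_simps)
    qed
    finally show "y \<in> ball x e" by (simp add: dist_norm)
  qed
  then show ?thesis using that[of k] e by (auto simp: k_def)
qed

text \<open>
  Maximality among cells in \<open>B\<close> is tested on proper ancestors only: these are the only larger cells
  that meet a given cell.
\<close>

definition maximal_cells :: "(int \<times> (int ^ 'n)) set \<Rightarrow> (int \<times> (int ^ 'n)) set" where
  "maximal_cells B = {q \<in> B. \<forall>i>0. ancestor i q \<notin> B}"

lemma maximal_cells_subset: "maximal_cells B \<subseteq> B"
  by (auto simp: maximal_cells_def)

lemma maximal_cells_disjoint:
  fixes B :: "(int \<times> (int ^ 'n)) set"
  shows "disjoint_family_on cell (maximal_cells B)"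
proof -
  have *: "p = q" if "p \<in> maximal_cells B" "q \<in> maximal_cells B" "x \<in> cell p" "x \<in> cell q" "fst p \<le> fst q"
    for p q :: "int \<times> (int ^ 'n)" and x
  proof -
    have q: "q = ancestor (nat (fst q - fst p)) p" using cell_common_ancestor that by blast
    show ?thesis
    proof (cases "nat (fst q - fst p) = 0")
      case True
      then show ?thesis using q by simp
    next
      case False
      then have "ancestor (nat (fst q - fst p)) p \<notin> B" using that(1) by (auto simp: maximal_cells_def)
      then show ?thesis using that(2) q by (auto simp: maximal_cells_def)
    qed
  qed
  have "p = q" if "p \<in> maximal_cells B" "q \<in> maximal_cells B" "x \<in> cell p" "x \<in> cell q" for p q x
    using *[OF that] *[OF that(2,1,4,3)] by (metis linorder_le_cases)
  then show ?thesis unfolding disjoint_family_on_def by blast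
qed

lemma maximal_ancestor:
  assumes b: "\<And>i. ancestor i p \<in> B \<Longrightarrow> i \<le> K" and p: "p \<in> B"
  obtains i where "ancestor i p \<in> maximal_cells B"
proof -
  define i where "i = Greatest (\<lambda>i. ancestor i p \<in> B)"
  have 0: "ancestor 0 p \<in> B" using p by simp
  have i: "ancestor i p \<in> B" unfolding i_def
    using GreatestI_nat[where P = "\<lambda>i. ancestor i p \<in> B", OF 0] b by blast
  have "ancestor l (ancestor i p) \<notin> B" if "l > 0" for l
  proof
    assume "ancestor l (ancestor i p) \<in> B"
    then have "l + i \<le> i" unfolding ancestor_ancestor i_def
      by (intro Greatest_le_nat[where b = K]) (use b in auto)
    then show False using that by simp
  qed
  then show ?thesis using that i by (auto simp: maximal_cells_def)
qed

lemma maximal_cells_cover: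
  assumes "\<And>q. q \<in> B \<Longrightarrow> fst q \<le> K" "p \<in> B"
  obtains i where "ancestor i p \<in> maximal_cells B"
proof (rule maximal_ancestor[of p B "nat (K - fst p)"])
  show "i \<le> nat (K - fst p)" if "ancestor i p \<in> B" for i using assms(1)[OF that] by simp
qed (use assms in auto)

section \<open>Sparse domination from a one-step estimate\<close>

text \<open>
  Only the sets \<open>A i\<close> have to be disjoint; the \<open>B i\<close> may overlap, and the two measures may differ.
  Thus one lemma serves Calderon-Zygmund selections, dilates of disjoint cells, and the comparison of
  \<open>g dx\<close> with Lebesgue measure.
\<close>

lemma emeasure_UN_le_scaled:
  fixes c :: ennreal
  assumes I: "countable I" and A: "\<And>i. i \<in> I \<Longrightarrow> A i \<in> sets M" and B: "\<And>i. i \<in> I \<Longrightarrow> B i \<in> sets M'"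
    and disj: "disjoint_family_on A I"
    and le: "\<And>i. i \<in> I \<Longrightarrow> emeasure M' (B i) \<le> c * emeasure M (A i)"
  shows "emeasure M' (\<Union>i\<in>I. B i) \<le> c * emeasure M (\<Union>i\<in>I. A i)"
proof -
  let ?J = "to_nat_on I ` I" and ?g = "from_nat_into I"
  define A' where "A' n = (if n \<in> ?J then A (?g n) else {})" for n
  define B' where "B' n = (if n \<in> ?J then B (?g n) else {})" for n
  have g: "?g n \<in> I" if "n \<in> ?J" for n using that I by auto
  have inv: "?g (to_nat_on I i) = i" if "i \<in> I" for i using that I by simp
  have UA: "(\<Union>i\<in>I. A i) = (\<Union>n. A' n)" using g inv by (fastforce simp: A'_def split: if_splits)
  have UB: "(\<Union>i\<in>I. B i) = (\<Union>n. B' n)" using g inv by (fastforce simp: B'_def split: if_splits)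
  have mA: "A' n \<in> sets M" and mB: "B' n \<in> sets M'" for n
    using A B g by (auto simp: A'_def B'_def)
  have dA: "disjoint_family A'"
    unfolding disjoint_family_on_def
  proof (intro ballI impI)
    fix m n :: nat assume "m \<noteq> n"
    show "A' m \<inter> A' n = {}"
    proof (cases "m \<in> ?J \<and> n \<in> ?J")
      case True
      then have "?g m \<noteq> ?g n" using \<open>m \<noteq> n\<close> inv by force
      then show ?thesis using disj True g by (auto simp: A'_def disjoint_family_on_def)
    qed (auto simp: A'_def)
  qed
  have "emeasure M' (\<Union>n. B' n) \<le> (\<Sum>n. emeasure M' (B' n))"
    by (rule emeasure_subadditive_countably) (use mB in auto)
  also have "\<dots> \<le> (\<Sum>n. c * emeasure M (A' n))"
    by (intro suminf_le) (use le g in \<open>auto simp: A'_def B'_def\<close>)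
  also have "\<dots> = c * (\<Sum>n. emeasure M (A' n))" by (rule ennreal_suminf_cmult)
  also have "(\<Sum>n. emeasure M (A' n)) = emeasure M (\<Union>n. A' n)"
    by (rule suminf_emeasure) (use mA dA in auto)
  finally show ?thesis unfolding UA UB .
qed

lemma infsum_ennreal_mono_set:
  fixes g :: "'b \<Rightarrow> ennreal"
  assumes "A \<subseteq> B" shows "infsum g A \<le> infsum g B"
  by (rule infsum_mono_neutral) (use assms in \<open>auto intro: nonneg_summable_on_complete\<close>)

lemma infsum_ennreal_insert_le:
  fixes g :: "'b \<Rightarrow> ennreal"
  assumes "A \<subseteq> B" "q \<in> B" "q \<notin> A" shows "g q + infsum g A \<le> infsum g B"
proof -
  have "g q + infsum g A = infsum g {q} + infsum g A" by simp
  also have "\<dots> = infsum g ({q} \<union> A)"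
    by (rule infsum_Un_disjoint[symmetric]) (use assms in \<open>auto intro: nonneg_summable_on_complete\<close>)
  also have "\<dots> \<le> infsum g B" by (rule infsum_ennreal_mono_set) (use assms in auto)
  finally show ?thesis .
qed

text \<open>
  Iterating the passage from a cell to its children turns a one-step estimate into sparse
  domination. The generations \<open>gen k\<close> are disjoint families, each covering at most half of the previous
  one. Hence almost every point lies in finitely many selected cells, so that the error term \<open>N P x\<close>
  disappears after finitely many steps. What a cell keeps after its children are removed is at least
  half of it, and these remainders are disjoint.
\<close>

lemma sparse_domination_of_step:
  fixes ch :: "int \<times> (int ^ 'n) \<Rightarrow> (int \<times> (int ^ 'n)) set" and a :: "int \<times> (int ^ 'n) \<Rightarrow> ennreal"
    and N :: "int \<times> (int ^ 'n) \<Rightarrow> real ^ 'n \<Rightarrow> ennreal"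
  assumes sub: "\<And>Q P. P \<in> ch Q \<Longrightarrow> cell P \<subseteq> cell Q"
    and disj: "\<And>Q. disjoint_family_on cell (ch Q)"
    and small: "\<And>Q. 2 * emeasure lebesgue (\<Union>P\<in>ch Q. cell P) \<le> emeasure lebesgue (cell Q)"
    and outside: "\<And>Q. AE x in lebesgue. x \<in> cell Q - (\<Union>P\<in>ch Q. cell P) \<longrightarrow> N Q x \<le> a Q"
    and inside: "\<And>Q P. P \<in> ch Q \<Longrightarrow> AE x in lebesgue. x \<in> cell P \<longrightarrow> N Q x \<le> a Q + N P x"
    and roots: "disjoint_family_on cell R"
  obtains F E where "disjoint_family_on E F"
    and "\<And>Q. Q \<in> F \<Longrightarrow> E Q \<in> sets lebesgue \<and> E Q \<subseteq> cell Q \<and>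
      emeasure lebesgue (cell Q) \<le> 2 * emeasure lebesgue (E Q)"
    and "AE x in lebesgue. \<forall>Q\<in>R. x \<in> cell Q \<longrightarrow> N Q x \<le> (\<Sum>\<^sub>\<infinity>Q\<in>F. a Q * indicator (cell Q) x)"
proof -
  define gen where "gen k = ((\<lambda>S. \<Union>(ch ` S)) ^^ k) R" for k
  have gen0: "gen 0 = R" and genS: "gen (Suc k) = (\<Union>Q\<in>gen k. ch Q)" for k
    by (simp_all add: gen_def)
  define F where "F = (\<Union>k. gen k)"
  define U where "U k = (\<Union>Q\<in>gen k. cell Q)" for k
  define C where "C Q = (\<Union>P\<in>ch Q. cell P)" for Q
  define E where "E Q = cell Q - C Q" for Q
  have C_sub: "C Q \<subseteq> cell Q" for Q unfolding C_def by (rule UN_least) (rule sub)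
  have C_meas: "C Q \<in> sets lebesgue" for Q
    unfolding C_def by (intro sets.countable_UN') auto
  have fin: "emeasure lebesgue (cell Q) < \<infinity>" "emeasure lebesgue (cell Q) > 0" for Q :: "int \<times> (int ^ 'n)"
    by (simp_all add: emeasure_cell)
  have gen_disj: "disjoint_family_on cell (gen k)" for k
  proof (induction k)
    case 0
    then show ?case by (simp add: gen0 roots)
  next
    case (Suc k)
    show ?case unfolding disjoint_family_on_def genS
    proof (intro ballI impI)
      fix P1 P2 assume "P1 \<in> (\<Union>Q\<in>gen k. ch Q)" "P2 \<in> (\<Union>Q\<in>gen k. ch Q)" "P1 \<noteq> P2"
      then obtain Q1 Q2 where *: "Q1 \<in> gen k" "P1 \<in> ch Q1" "Q2 \<in> gen k" "P2 \<in> ch Q2" "P1 \<noteq> P2"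
        by blast
      show "cell P1 \<inter> cell P2 = {}"
      proof (cases "Q1 = Q2")
        case True
        then show ?thesis using disj[of Q2] * unfolding disjoint_family_on_def by blast
      next
        case False
        then have "cell Q1 \<inter> cell Q2 = {}" using Suc * unfolding disjoint_family_on_def by blast
        then show ?thesis using sub[OF *(2)] sub[OF *(4)] by blast
      qed
    qed
  qed
  have gen_sub: "\<exists>q\<in>gen k. cell p \<subseteq> cell q" if "p \<in> gen (k + d)" for p k d
    using that
  proof (induction d arbitrary: p)
    case (Suc d)
    then obtain q where "q \<in> gen (k + d)" "p \<in> ch q" by (auto simp: genS)
    then show ?case using Suc.IH sub by blast
  qed auto
  have E_disj: "disjoint_family_on E F"
  proof -
    have *: "E p \<inter> E q = {}" if pq: "p \<in> gen (k + d)" "q \<in> gen k" "p \<noteq> q" for p q k d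
    proof (cases d)
      case 0
      then have "cell p \<inter> cell q = {}" using that gen_disj[of k] by (auto simp: disjoint_family_on_def)
      then show ?thesis by (auto simp: E_def)
    next
      case (Suc d')
      then have "p \<in> gen (Suc k + d')" using pq by simp
      then obtain p' where p': "p' \<in> gen (Suc k)" "cell p \<subseteq> cell p'" using gen_sub by blast
      then obtain q' where q': "q' \<in> gen k" "p' \<in> ch q'" by (auto simp: genS)
      show ?thesis
      proof (cases "q' = q")
        case True
        then show ?thesis using p' q' by (auto simp: E_def C_def)
      next
        case False
        then have "cell q' \<inter> cell q = {}" using q' that gen_disj[of k] unfolding disjoint_family_on_def by blast
        then show ?thesis using p'(2) sub[OF q'(2)] unfolding E_def by blast
      qed
    qed
    have "E p \<inter> E q = {}" if pq: "p \<in> F" "q \<in> F" "p \<noteq> q" for p q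
    proof -
      obtain k l where kl: "p \<in> gen k" "q \<in> gen l" using pq unfolding F_def by blast
      show ?thesis
      proof (cases "l \<le> k")
        case True
        then show ?thesis using *[of p l "k - l" q] kl that by simp
      next
        case False
        then show ?thesis using *[of q k "l - k" p] kl that by (simp add: Int_commute)
      qed
    qed
    then show ?thesis by (auto simp: disjoint_family_on_def)
  qed
  have E_prop: "E Q \<in> sets lebesgue \<and> E Q \<subseteq> cell Q \<and>
      emeasure lebesgue (cell Q) \<le> 2 * emeasure lebesgue (E Q)" for Q
  proof -
    let ?m = "emeasure lebesgue"
    have m: "?m (cell Q) = ?m (E Q) + ?m (C Q)"
    proof -
      have "E Q \<in> sets lebesgue" "E Q \<inter> C Q = {}" "E Q \<union> C Q = cell Q"
        using C_meas[of Q] C_sub[of Q] by (auto simp: E_def)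
      then show ?thesis using plus_emeasure[of "E Q" lebesgue "C Q"] C_meas[of Q] by simp
    qed
    have s: "2 * ?m (C Q) \<le> ?m (cell Q)" using small by (simp add: C_def)
    have f: "?m (E Q) < \<infinity>" "?m (C Q) < \<infinity>" using fin(1)[of Q] m by auto
    obtain e c where ec: "?m (E Q) = ennreal e" "?m (C Q) = ennreal c" "0 \<le> e" "0 \<le> c"
      using f by (metis ennreal_cases infinity_ennreal_def less_irrefl)
    have "ennreal (2 * c) \<le> ennreal (e + c)" using s m ec by (simp add: ennreal_mult)
    then have "c \<le> e" using ec by (subst (asm) ennreal_le_iff) auto
    then have "ennreal (e + c) \<le> ennreal (2 * e)" by (intro ennreal_leI) simp
    then show ?thesis using m ec C_meas[of Q] by (auto simp: ennreal_mult E_def)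
  qed
  have null: "(\<Inter>k. U k) \<inter> cell Q0 \<in> null_sets lebesgue" if Q0: "Q0 \<in> R" for Q0
  proof -
    let ?m = "emeasure lebesgue"
    have U_meas: "U k \<in> sets lebesgue" for k unfolding U_def by (intro sets.countable_UN') auto
    have dec: "?m (U k \<inter> cell Q0) \<le> ennreal ((1/2)^k) * ?m (cell Q0)" for k
    proof (induction k)
      case 0
      then show ?case using emeasure_mono[of "U 0 \<inter> cell Q0" "cell Q0" lebesgue] by simp
    next
      case (Suc k)
      define I where "I = {Q \<in> gen k. cell Q \<subseteq> cell Q0}"
      have in_I: "Q \<in> I" if Q: "Q \<in> gen k" "x \<in> cell Q" "x \<in> cell Q0" for Q x
      proof -
        obtain q where q: "q \<in> R" "cell Q \<subseteq> cell q" using gen_sub[of Q 0 k] Q(1) by (auto simp: gen0)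
        then have "q = Q0" using roots Q0 Q unfolding disjoint_family_on_def by blast
        then show ?thesis using Q q by (auto simp: I_def)
      qed
      have "U (Suc k) \<inter> cell Q0 \<subseteq> (\<Union>Q\<in>I. C Q)"
      proof
        fix x assume "x \<in> U (Suc k) \<inter> cell Q0"
        then obtain Q P where "Q \<in> gen k" "P \<in> ch Q" "x \<in> cell P" "x \<in> cell Q0"
          by (auto simp: U_def genS)
        then show "x \<in> (\<Union>Q\<in>I. C Q)" using in_I[of Q x] sub[of P Q] by (auto simp: C_def)
      qed
      then have "?m (U (Suc k) \<inter> cell Q0) \<le> ?m (\<Union>Q\<in>I. C Q)"
        using C_meas by (intro emeasure_mono sets.countable_UN') blast+
      also have "\<dots> \<le> ennreal (1/2) * ?m (\<Union>Q\<in>I. cell Q)"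
      proof (rule emeasure_UN_le_scaled)
        show "disjoint_family_on cell I" using gen_disj[of k] by (auto simp: I_def disjoint_family_on_def)
        show "?m (C Q) \<le> ennreal (1/2) * ?m (cell Q)" if "Q \<in> I" for Q
        proof -
          have "ennreal (1/2) * (2 * ?m (C Q)) \<le> ennreal (1/2) * ?m (cell Q)"
            using small[of Q] by (intro mult_left_mono) (auto simp: C_def)
          moreover have "ennreal (1/2) * (2 * ?m (C Q)) = ?m (C Q)"
            unfolding mult.assoc[symmetric] ennreal_numeral[symmetric]
            by (subst ennreal_mult[symmetric]) auto
          ultimately show ?thesis by simp
        qed
        show "C Q \<in> sets lebesgue" for Q by (rule C_meas)
      qed auto
      also have "\<dots> \<le> ennreal (1/2) * ?m (U k \<inter> cell Q0)"
        by (intro mult_left_mono emeasure_mono sets.Int U_meas) (auto simp: I_def U_def)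
      also have "\<dots> \<le> ennreal (1/2) * (ennreal ((1/2)^k) * ?m (cell Q0))"
        by (intro mult_left_mono Suc) auto
      also have "\<dots> = ennreal ((1/2) ^ Suc k) * ?m (cell Q0)"
        unfolding mult.assoc[symmetric] by (subst ennreal_mult[symmetric]) auto
      finally show ?case .
    qed
    have "?m ((\<Inter>k. U k) \<inter> cell Q0) \<le> ennreal ((1/2)^k * side Q0 ^ CARD('n))" for k
    proof -
      have "?m ((\<Inter>k. U k) \<inter> cell Q0) \<le> ?m (U k \<inter> cell Q0)"
        by (intro emeasure_mono sets.Int U_meas) auto
      also note dec[of k]
      finally show ?thesis by (simp add: emeasure_cell ennreal_mult)
    qed
    moreover have "(\<lambda>k. ennreal ((1/2)^k * side Q0 ^ CARD('n))) \<longlonglongrightarrow> ennreal (0 * side Q0 ^ CARD('n))"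
      by (intro tendsto_ennrealI tendsto_mult LIMSEQ_power_zero tendsto_const) auto
    ultimately have "?m ((\<Inter>k. U k) \<inter> cell Q0) \<le> 0"
      by (intro LIMSEQ_le_const[of "\<lambda>k. ennreal ((1/2)^k * side Q0 ^ CARD('n))"]) auto
    then show ?thesis using U_meas by (intro null_setsI) (auto intro!: sets.countable_INT'')
  qed
  have ae: "AE x in lebesgue. \<forall>Q\<in>R. x \<in> cell Q \<longrightarrow> N Q x \<le> (\<Sum>\<^sub>\<infinity>Q\<in>F. a Q * indicator (cell Q) x)"
  proof -
    have 1: "AE x in lebesgue. \<forall>Q. x \<in> cell Q - C Q \<longrightarrow> N Q x \<le> a Q"
      unfolding AE_all_countable using outside by (auto simp: C_def)
    have 2: "AE x in lebesgue. \<forall>Q P. P \<in> ch Q \<longrightarrow> x \<in> cell P \<longrightarrow> N Q x \<le> a Q + N P x"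
      unfolding AE_all_countable
    proof (intro allI)
      fix Q P show "AE x in lebesgue. P \<in> ch Q \<longrightarrow> x \<in> cell P \<longrightarrow> N Q x \<le> a Q + N P x"
        using inside by (cases "P \<in> ch Q") auto
    qed
    have 3: "AE x in lebesgue. \<forall>Q\<in>R. x \<notin> (\<Inter>k. U k) \<inter> cell Q"
      using null by (intro AE_ball_countable[THEN iffD2] ballI AE_not_in) auto
    show ?thesis using 1 2 3
    proof (eventually_elim, intro ballI impI)
      fix x Q assume x1: "\<forall>Q. x \<in> cell Q - C Q \<longrightarrow> N Q x \<le> a Q"
        and x2: "\<forall>Q P. P \<in> ch Q \<longrightarrow> x \<in> cell P \<longrightarrow> N Q x \<le> a Q + N P x"
        and x3: "\<forall>Q\<in>R. x \<notin> (\<Inter>k. U k) \<inter> cell Q" and Q: "Q \<in> R" "x \<in> cell Q"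
      obtain K where K: "x \<notin> U K" using x3 Q by blast
      let ?g = "\<lambda>Q. a Q * indicator (cell Q) x"
      \<comment> \<open>Downward induction over the generations: by the choice of \<open>K\<close> no cell of generation \<open>K\<close> contains \<open>x\<close>.\<close>
      have key: "N q x \<le> infsum ?g {p \<in> F. cell p \<subseteq> cell q}" if "k + d = K" "q \<in> gen k" "x \<in> cell q" for k d q
        using that
      proof (induction d arbitrary: k q)
        case 0
        then show ?case using K by (auto simp: U_def)
      next
        case (Suc d)
        have q: "q \<in> F" using Suc.prems by (auto simp: F_def)
        have gq: "?g q = a q" using Suc.prems by simp
        show ?case
        proof (cases "x \<in> C q")
          case True
          then obtain p where p: "p \<in> ch q" "x \<in> cell p" by (auto simp: C_def)
          have pg: "p \<in> gen (Suc k)" using p Suc.prems by (auto simp: genS)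
          have "N q x \<le> ?g q + N p x" using x2[rule_format, OF p] unfolding gq .
          also have "N p x \<le> infsum ?g {r \<in> F. cell r \<subseteq> cell p}"
            by (rule Suc.IH[of "Suc k"]) (use Suc.prems pg p in auto)
          also have "?g q + infsum ?g {r \<in> F. cell r \<subseteq> cell p} \<le> infsum ?g {r \<in> F. cell r \<subseteq> cell q}"
          proof (rule infsum_ennreal_insert_le)
            show "{r \<in> F. cell r \<subseteq> cell p} \<subseteq> {r \<in> F. cell r \<subseteq> cell q}" using sub p by blast
            show "q \<notin> {r \<in> F. cell r \<subseteq> cell p}"
            proof
              assume "q \<in> {r \<in> F. cell r \<subseteq> cell p}"
              then have "cell q \<subseteq> C q" using p by (auto simp: C_def)
              then have "emeasure lebesgue (cell q) \<le> emeasure lebesgue (C q)"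
                by (rule emeasure_mono) (rule C_meas)
              then have "2 * emeasure lebesgue (cell q) \<le> 2 * emeasure lebesgue (C q)"
                by (rule mult_left_mono) simp
              also have "\<dots> \<le> emeasure lebesgue (cell q)" using small[of q] by (simp add: C_def)
              finally have "2 * emeasure lebesgue (cell q) \<le> emeasure lebesgue (cell q)" .
              then have "ennreal (2 * side q ^ CARD('n)) \<le> ennreal (side q ^ CARD('n))"
                by (simp add: emeasure_cell ennreal_mult)
              then have "2 * side q ^ CARD('n) \<le> side q ^ CARD('n)" by (subst (asm) ennreal_le_iff) auto
              moreover have "side q ^ CARD('n) > 0" by simp
              ultimately show False by linarith
            qed
          qed (use q in auto)
          finally show ?thesis by (simp add: add_left_mono)
        next
          case False
          then have "N q x \<le> a q" using x1 Suc.prems by blast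
          also have "\<dots> = infsum ?g {q}" using gq by simp
          also have "\<dots> \<le> infsum ?g {r \<in> F. cell r \<subseteq> cell q}"
            by (rule infsum_ennreal_mono_set) (use q in auto)
          finally show ?thesis .
        qed
      qed
      have "N Q x \<le> infsum ?g {p \<in> F. cell p \<subseteq> cell Q}" using key[of 0 K Q] Q by (simp add: gen0)
      also have "\<dots> \<le> infsum ?g F" by (rule infsum_ennreal_mono_set) auto
      finally show "N Q x \<le> infsum ?g F" .
    qed
  qed
  show ?thesis by (rule that[OF E_disj E_prop ae])
qed

section \<open>Integrals over products and the Hoermander condition\<close>

lemma borel_measurable_vec_component [measurable]: "(\<lambda>y :: real ^ 'n ^ 'm. y $ i) \<in> borel_measurable borel"
  by (intro borel_measurable_continuous_onI continuous_intros)

lemma borel_imp_lebesgue_measurable: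
  assumes "f \<in> borel_measurable borel" shows "f \<in> borel_measurable lebesgue"
  using assms by (intro measurable_completion) simp

lemma prod_Basis_vec:
  fixes f :: "real ^ 'n ^ 'm \<Rightarrow> 'b::comm_monoid_mult"
  shows "(\<Prod>b\<in>Basis. f b) = (\<Prod>i\<in>UNIV. \<Prod>b\<in>Basis. f (axis i b))"
proof -
  have "(\<Prod>i\<in>UNIV. \<Prod>b\<in>Basis. f (axis i b)) = (\<Prod>(i, b)\<in>UNIV \<times> Basis. f (axis i b))"
    by (rule prod.cartesian_product)
  also have "\<dots> = (\<Prod>p\<in>UNIV \<times> Basis. f (axis (fst p) (snd p)))" by (simp add: split_def)
  also have "\<dots> = (\<Prod>b\<in>Basis. f b)"
  proof (rule prod.reindex_bij_betw)
    show "bij_betw (\<lambda>p. axis (fst p) (snd p)) (UNIV \<times> Basis) (Basis :: (real ^ 'n ^ 'm) set)"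
      by (force simp: bij_betw_def inj_on_def Basis_vec_def axis_eq_axis image_iff)
  qed
  finally show ?thesis by simp
qed

lemma measurable_vec_lambda:
  "vec_lambda \<in> measurable (\<Pi>\<^sub>M i\<in>(UNIV :: 'm::finite set). lborel) (borel :: (real ^ 'n ^ 'm) measure)"
proof (subst borel_measurable_euclidean_space, intro ballI)
  fix b :: "real ^ 'n ^ 'm" assume "b \<in> Basis"
  then obtain i c where b: "b = axis i c" by (auto simp: Basis_vec_def)
  have "(\<lambda>f. f i) \<in> measurable (\<Pi>\<^sub>M i\<in>UNIV. lborel) (borel :: (real ^ 'n) measure)"
    using measurable_component_singleton[of i UNIV "\<lambda>_. lborel :: (real ^ 'n) measure"] by simp
  then show "(\<lambda>f. vec_lambda f \<bullet> b) \<in> borel_measurable (\<Pi>\<^sub>M i\<in>(UNIV :: 'm set). lborel)"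
    by (simp add: b inner_axis)
qed

text \<open>
  This identifies Lebesgue measure on \<open>(\<real>\<^sup>n)\<^sup>m\<close> with the \<open>m\<close>-fold product measure and thereby makes
  Fubini's theorem for tensor products available.
\<close>

lemma lborel_vec_eq_distr_PiM:
  "(lborel :: (real ^ 'n ^ 'm) measure) = distr (\<Pi>\<^sub>M i\<in>UNIV. lborel) borel vec_lambda"
proof (rule lborel_eqI)
  let ?P = "\<Pi>\<^sub>M i\<in>(UNIV :: 'm set). (lborel :: (real ^ 'n) measure)"
  interpret product_sigma_finite "\<lambda>_ :: 'm. lborel :: (real ^ 'n) measure" by standard
  note meas = measurable_vec_lambda
  fix l u :: "real ^ 'n ^ 'm"
  assume lu: "\<And>b. b \<in> Basis \<Longrightarrow> l \<bullet> b \<le> u \<bullet> b"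
  have lu': "l $ i \<bullet> b \<le> u $ i \<bullet> b" if "b \<in> Basis" for i b
    using lu[of "axis i b"] that by (auto simp: Basis_vec_def inner_axis)
  have pre: "vec_lambda -` box l u \<inter> space ?P = Pi\<^sub>E UNIV (\<lambda>i. box (l $ i) (u $ i))"
    by (auto simp: space_PiM PiE_def Pi_iff mem_box Basis_vec_def inner_axis)
  have "emeasure (distr ?P borel vec_lambda) (box l u) = emeasure ?P (Pi\<^sub>E UNIV (\<lambda>i. box (l $ i) (u $ i)))"
    by (subst emeasure_distr[OF meas]) (simp_all add: pre)
  also have "\<dots> = (\<Prod>i\<in>UNIV. emeasure lborel (box (l $ i) (u $ i)))"
    by (rule emeasure_PiM) auto
  also have "\<dots> = (\<Prod>i\<in>UNIV. ennreal (\<Prod>b\<in>Basis. (u $ i - l $ i) \<bullet> b))"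
    using lu' by (intro prod.cong refl emeasure_lborel_box) auto
  also have "\<dots> = ennreal (\<Prod>i\<in>UNIV. \<Prod>b\<in>Basis. (u $ i - l $ i) \<bullet> b)"
    by (rule prod_ennreal) (use lu' in \<open>auto intro!: prod_nonneg simp: inner_diff_left\<close>)
  also have "\<dots> = ennreal (\<Prod>b\<in>Basis. (u - l) \<bullet> b)"
    unfolding prod_Basis_vec by (simp add: inner_axis)
  finally show "emeasure (distr ?P borel vec_lambda) (box l u) = ennreal (\<Prod>b\<in>Basis. (u - l) \<bullet> b)" .
next
  show "sets (distr (\<Pi>\<^sub>M i\<in>UNIV. lborel) borel vec_lambda) = sets borel" by simp
qed

lemma nn_integral_prod_vec:
  fixes g :: "'m::finite \<Rightarrow> real ^ 'n \<Rightarrow> ennreal"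
  assumes [measurable]: "\<And>i. g i \<in> borel_measurable borel"
  shows "(\<integral>\<^sup>+y. (\<Prod>i\<in>UNIV. g i (y $ i)) \<partial>lebesgue) = (\<Prod>i\<in>UNIV. \<integral>\<^sup>+x. g i x \<partial>lebesgue)"
proof -
  let ?P = "\<Pi>\<^sub>M i\<in>(UNIV :: 'm set). (lborel :: (real ^ 'n) measure)"
  interpret product_sigma_finite "\<lambda>_ :: 'm. lborel :: (real ^ 'n) measure" by standard
  note meas = measurable_vec_lambda
  have "(\<integral>\<^sup>+y. (\<Prod>i\<in>UNIV. g i (y $ i)) \<partial>lebesgue) = (\<integral>\<^sup>+y. (\<Prod>i\<in>UNIV. g i (y $ i)) \<partial>lborel)"
    by (rule nn_integral_completion)
  also have "\<dots> = (\<integral>\<^sup>+f. (\<Prod>i\<in>UNIV. g i (vec_lambda f $ i)) \<partial>?P)"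
    unfolding lborel_vec_eq_distr_PiM by (rule nn_integral_distr[OF meas]) measurable
  also have "\<dots> = (\<Prod>i\<in>UNIV. \<integral>\<^sup>+x. g i x \<partial>lborel)"
    using product_nn_integral_prod[of UNIV g] by simp
  finally show ?thesis by (simp add: nn_integral_completion)
qed

text \<open>
  Hoelder's inequality, from Young's inequality for the functions normalised by their norms. Real bounds
  \<open>a\<close>, \<open>b\<close> for the two integrals replace the norms, which avoids products of \<open>0\<close> and \<open>\<infinity>\<close>.
\<close>

lemma nn_integral_Holder:
  fixes u v :: "'b \<Rightarrow> real"
  assumes p: "1 < p" "1 < q" "1 / p + 1 / q = 1"
    and [measurable]: "u \<in> borel_measurable M" "v \<in> borel_measurable M"
    and nonneg: "\<And>x. 0 \<le> u x" "\<And>x. 0 \<le> v x"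
    and a: "(\<integral>\<^sup>+x. ennreal (u x powr p) \<partial>M) \<le> ennreal a" "0 \<le> a"
    and b: "(\<integral>\<^sup>+x. ennreal (v x powr q) \<partial>M) \<le> ennreal b" "0 \<le> b"
  shows "(\<integral>\<^sup>+x. ennreal (u x * v x) \<partial>M) \<le> ennreal (a powr (1 / p) * b powr (1 / q))"
proof (cases "a = 0 \<or> b = 0")
  case True
  have *: "AE x in M. w x = 0" if "(\<integral>\<^sup>+x. ennreal (w x powr s) \<partial>M) \<le> 0" "w \<in> borel_measurable M"
    for w :: "'b \<Rightarrow> real" and s
  proof -
    note [measurable] = that(2)
    have "(\<integral>\<^sup>+x. ennreal (w x powr s) \<partial>M) = 0" using that(1) by simp
    then have "AE x in M. ennreal (w x powr s) = 0" by (subst (asm) nn_integral_0_iff_AE) auto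
    then show ?thesis
    proof eventually_elim
      case (elim x)
      then have "w x powr s = 0" by (simp add: ennreal_eq_0_iff antisym)
      then show ?case by simp
    qed
  qed
  have "AE x in M. u x * v x = 0"
    using True *[of u p] *[of v q] a b by (auto elim!: eventually_mono)
  then have "(\<integral>\<^sup>+x. ennreal (u x * v x) \<partial>M) = 0"
    by (subst nn_integral_0_iff_AE) (auto elim!: eventually_mono)
  then show ?thesis by simp
next
  case False
  then have a0: "a > 0" and b0: "b > 0" using a b by auto
  define A where "A = a powr (1 / p)"
  define B where "B = b powr (1 / q)"
  have AB: "A > 0" "B > 0" "A powr p = a" "B powr q = b"
    using a0 b0 p by (auto simp: A_def B_def powr_powr)
  have pt: "u x * v x \<le> (A * B / (a * p)) * u x powr p + (A * B / (b * q)) * v x powr q" for x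
  proof -
    have "(u x / A) * (v x / B) \<le> (u x / A) powr p / p + (v x / B) powr q / q"
      using AB nonneg p by (intro Youngs_inequality) auto
    also have "\<dots> = u x powr p / (a * p) + v x powr q / (b * q)"
      using AB nonneg by (simp add: powr_divide)
    finally have "(A * B) * ((u x / A) * (v x / B)) \<le> (A * B) * (u x powr p / (a * p) + v x powr q / (b * q))"
      using AB by (intro mult_left_mono) auto
    then show ?thesis using AB by (simp add: algebra_simps)
  qed
  have "(\<integral>\<^sup>+x. ennreal (u x * v x) \<partial>M)
      \<le> (\<integral>\<^sup>+x. ennreal (A * B / (a * p)) * ennreal (u x powr p) + ennreal (A * B / (b * q)) * ennreal (v x powr q) \<partial>M)"
    using pt AB a0 b0 p
    by (intro nn_integral_mono) (simp add: ennreal_mult[symmetric] ennreal_plus[symmetric] del: ennreal_plus)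
  also have "\<dots> = ennreal (A * B / (a * p)) * (\<integral>\<^sup>+x. ennreal (u x powr p) \<partial>M)
      + ennreal (A * B / (b * q)) * (\<integral>\<^sup>+x. ennreal (v x powr q) \<partial>M)"
    by (subst nn_integral_add) (auto simp: nn_integral_cmult)
  also have "\<dots> \<le> ennreal (A * B / (a * p)) * ennreal a + ennreal (A * B / (b * q)) * ennreal b"
    using a b by (intro add_mono mult_left_mono) auto
  also have "\<dots> = ennreal (A * B * (1 / p + 1 / q))"
    using AB a0 b0 p
    by (simp add: ennreal_mult[symmetric] ennreal_plus[symmetric] field_simps del: ennreal_plus)
  finally show ?thesis using p by (simp add: A_def B_def)
qed

text \<open>
  Hoelder's inequality against the dual norm of the Hoermander condition. In the application \<open>g\<close> is a
  difference \<open>K x - K z\<close> of sections of the kernel, which may fail to be measurable, while \<open>W\<close> is measurable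
  because it comes from absolutely convergent integrals. Hence \<open>g\<close> occurs only as a pointwise bound.
\<close>

lemma nn_integral_le_dual_norm:
  fixes W :: "real ^ 'n ^ 'm \<Rightarrow> 'a::{real_normed_field, banach, second_countable_topology}"
  assumes r: "1 \<le> r"
    and A: "A \<in> sets lebesgue"
    and W: "W \<in> borel_measurable lebesgue" and v: "v \<in> borel_measurable lebesgue" "\<And>y. 0 \<le> v y"
    and le: "\<And>y. norm (W y) \<le> norm (g y) * v y"
    and b: "(\<integral>\<^sup>+y\<in>A. ennreal (v y powr r) \<partial>lebesgue) \<le> ennreal b" "0 \<le> b"
    and fin: "dual_norm_on r A g < \<infinity>"
  shows "(\<integral>\<^sup>+y\<in>A. ennreal (norm (W y)) \<partial>lebesgue) \<le> dual_norm_on r A g * ennreal (b powr (1 / r))"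
proof (cases "r = 1")
  case True
  note [measurable] = A W v(1)
  define S where "S = dual_norm_on r A g"
  have S: "S = esssup (lebesgue_on A) (\<lambda>y. ennreal (norm (g y)))"
    by (simp add: S_def dual_norm_on_def True)
  have "AE y in lebesgue_on A. ennreal (norm (g y)) \<le> S" unfolding S by (rule esssup_AE)
  then have "AE y in lebesgue. y \<in> A \<longrightarrow> ennreal (norm (g y)) \<le> S"
    using A by (subst (asm) AE_restrict_space_iff) auto
  then have "AE y in lebesgue. ennreal (norm (W y)) * indicator A y \<le> S * (ennreal (v y powr r) * indicator A y)"
  proof eventually_elim
    case (elim y)
    have "ennreal (norm (W y)) \<le> ennreal (norm (g y)) * ennreal (v y)"
      using le[of y] v(2)[of y] by (simp add: ennreal_mult[symmetric])
    then have "y \<in> A \<Longrightarrow> ennreal (norm (W y)) \<le> S * ennreal (v y)"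
      using elim by (meson mult_right_mono order_trans zero_le)
    then show ?case using v(2)[of y] by (auto simp: True indicator_def)
  qed
  then have "(\<integral>\<^sup>+y\<in>A. ennreal (norm (W y)) \<partial>lebesgue) \<le> (\<integral>\<^sup>+y. S * (ennreal (v y powr r) * indicator A y) \<partial>lebesgue)"
    by (rule nn_integral_mono_AE)
  also have "\<dots> = S * (\<integral>\<^sup>+y\<in>A. ennreal (v y powr r) \<partial>lebesgue)" by (rule nn_integral_cmult) measurable
  also have "\<dots> \<le> S * ennreal b" using b by (intro mult_left_mono) auto
  finally show ?thesis using True b by (simp add: S_def)
next
  case False
  note [measurable] = A W v(1)
  define q where "q = r / (r - 1)"
  have r1: "r > 1" using r False by simp
  have q: "1 < q" "1 / q + 1 / r = 1" using r1 by (auto simp: q_def field_simps)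
  \<comment> \<open>The quotient \<open>|W| / v\<close> is measurable and dominated by \<open>|g|\<close>, so that \<open>g\<close> enters only
    through monotonicity of the integral.\<close>
  define u where "u y = (if v y = 0 then 0 else norm (W y) / v y) * indicator A y" for y
  have u_meas: "u \<in> borel_measurable lebesgue" unfolding u_def by measurable
  have u0: "0 \<le> u y" for y using v by (auto simp: u_def indicator_def)
  have ug: "u y \<le> norm (g y) * indicator A y" for y
    using le[of y] v(2)[of y] by (auto simp: u_def indicator_def divide_le_eq)
  define I where "I = (\<integral>\<^sup>+y\<in>A. ennreal (norm (g y) powr q) \<partial>lebesgue)"
  have dn: "dual_norm_on r A g = ennpowr I (1 / q)"
    using False by (simp add: dual_norm_on_def I_def q_def Let_def)
  then have "I \<noteq> \<infinity>" using fin by (auto simp: ennpowr_def)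
  then obtain a where a: "I = ennreal a" "0 \<le> a" by (cases I) auto
  have dn': "dual_norm_on r A g = ennreal (a powr (1 / q))" using a by (simp add: dn ennpowr_def)
  have "(\<integral>\<^sup>+y. ennreal (u y * (v y * indicator A y)) \<partial>lebesgue) \<le> ennreal (a powr (1 / q) * b powr (1 / r))"
  proof (rule nn_integral_Holder[OF q(1) r1 q(2) u_meas])
    show "(\<lambda>y. v y * indicator A y) \<in> borel_measurable lebesgue" by measurable
    have "(\<integral>\<^sup>+y. ennreal (u y powr q) \<partial>lebesgue) \<le> I" unfolding I_def
    proof (rule nn_integral_mono)
      fix y show "ennreal (u y powr q) \<le> ennreal (norm (g y) powr q) * indicator A y"
        using ug[of y] u0[of y] q by (auto simp: indicator_def u_def intro!: ennreal_leI powr_mono2)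
    qed
    then show "(\<integral>\<^sup>+y. ennreal (u y powr q) \<partial>lebesgue) \<le> ennreal a" using a by simp
    have "(\<integral>\<^sup>+y. ennreal ((v y * indicator A y) powr r) \<partial>lebesgue) = (\<integral>\<^sup>+y\<in>A. ennreal (v y powr r) \<partial>lebesgue)"
      by (intro nn_integral_cong) (auto simp: indicator_def)
    then show "(\<integral>\<^sup>+y. ennreal ((v y * indicator A y) powr r) \<partial>lebesgue) \<le> ennreal b" using b by simp
  qed (use u0 v a b in auto)
  moreover have "(\<integral>\<^sup>+y. ennreal (u y * (v y * indicator A y)) \<partial>lebesgue) = (\<integral>\<^sup>+y\<in>A. ennreal (norm (W y)) \<partial>lebesgue)"
  proof (intro nn_integral_cong)
    fix y show "ennreal (u y * (v y * indicator A y)) = ennreal (norm (W y)) * indicator A y"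
      using le[of y] by (auto simp: u_def indicator_def)
  qed
  ultimately show ?thesis by (simp add: dn' ennreal_mult)
qed

lemma closed_set_pow: "closed Q \<Longrightarrow> closed (set_pow Q :: (real ^ 'n ^ 'm) set)"
proof -
  assume Q: "closed Q"
  have "set_pow Q = (\<Inter>i. (\<lambda>y :: real ^ 'n ^ 'm. y $ i) -` Q)" by (auto simp: set_pow_def)
  then show ?thesis using Q by (auto intro!: closed_INT closed_vimage continuous_intros)
qed

lemma set_pow_cube_borel [measurable, simp]: "set_pow (cube c l) \<in> sets borel"
  by (simp add: closed_set_pow borel_closed)

lemma annulus_borel [measurable, simp]: "annulus k c l \<in> sets borel"
  unfolding annulus_def by measurable

lemma set_pow_cube_exhaust:
  fixes y :: "real ^ 'n ^ 'm"
  assumes "0 < l" shows "\<exists>k. y \<in> set_pow (cube c (2 ^ k * l))"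
proof -
  define M where "M = (\<Sum>i\<in>UNIV. \<Sum>j\<in>UNIV. \<bar>y $ i $ j - c $ j\<bar>)"
  have M: "\<bar>y $ i $ j - c $ j\<bar> \<le> M" for i j
  proof -
    have "\<bar>y $ i $ j - c $ j\<bar> \<le> (\<Sum>j\<in>UNIV. \<bar>y $ i $ j - c $ j\<bar>)"
      by (rule member_le_sum) auto
    also have "\<dots> \<le> M" unfolding M_def
      by (rule member_le_sum[of i UNIV "\<lambda>i. \<Sum>j\<in>UNIV. \<bar>y $ i $ j - c $ j\<bar>"]) (auto intro: sum_nonneg)
    finally show ?thesis .
  qed
  obtain k where "2 * M / l < 2 ^ k" using real_arch_pow[of 2 "2 * M / l"] by auto
  then have "M \<le> 2 ^ k * l / 2" using assms by (simp add: field_simps)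
  then have "y \<in> set_pow (cube c (2 ^ k * l))" using M
    unfolding set_pow_def cube_def mem_Collect_eq by (meson order_trans)
  then show ?thesis ..
qed

text \<open>
  The complement of \<open>Q\<^sup>m\<close> is the union of the annuli \<open>(2\<^sup>kQ)\<^sup>m - (2\<^bsup>k-1\<^esup>Q)\<^sup>m\<close>, \<open>k \<ge> 1\<close>. On each of them,
  Hoelder's inequality bounds the integral by the dual norm of the kernel difference times
  \<open>|2\<^sup>kQ|\<^bsup>m/r\<^esup>\<close> times a product of averages over \<open>2\<^sup>kQ\<close>. If all these averages are bounded by \<open>b\<close>, the
  series that remains is the one in the definition of \<open>K\<^sub>r\<close>.
\<close>

lemma hormander_integral_le:
  fixes K :: "real ^ 'n \<Rightarrow> real ^ 'n ^ 'm \<Rightarrow> 'a::{real_normed_field, banach, second_countable_topology}"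
    and W :: "real ^ 'n ^ 'm \<Rightarrow> 'a" and h :: "'m \<Rightarrow> real ^ 'n \<Rightarrow> real"
  assumes r: "1 \<le> r" and l: "0 < l" and fin: "hormander_const r K < \<infinity>"
    and xz: "x \<in> cube c (l / 2)" "z \<in> cube c (l / 2)"
    and W: "W \<in> borel_measurable lebesgue"
    and h: "\<And>i. h i \<in> borel_measurable borel" "\<And>i t. 0 \<le> h i t"
    and le: "\<And>y. norm (W y) \<le> norm (K x y - K z y) * (\<Prod>i\<in>UNIV. h i (y $ i))"
    and zero: "\<And>y. y \<in> set_pow (cube c l) \<Longrightarrow> W y = 0"
    and b: "\<And>k i. 1 \<le> k \<Longrightarrow> (\<integral>\<^sup>+t\<in>cube c (2 ^ k * l). ennreal (h i t powr r) \<partial>lebesgue)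
        \<le> ennreal (measure lebesgue (cube c (2 ^ k * l)) * b i)"
    and b0: "\<And>i. 0 \<le> b i"
  shows "(\<integral>\<^sup>+y. ennreal (norm (W y)) \<partial>lebesgue) \<le> hormander_const r K * ennreal ((\<Prod>i\<in>UNIV. b i) powr (1 / r))"
proof -
  note [measurable] = W h(1)
  let ?A = "\<lambda>k. annulus k c l" and ?Q = "\<lambda>k. cube c (2 ^ k * l)"
  let ?g = "\<lambda>y. K x y - K z y" and ?m = "real CARD('m)"
  let ?B = "(\<Prod>i\<in>UNIV. b i) powr (1 / r)"
  define t where "t k = ennreal (measure lebesgue (?Q k) powr (?m / r)) * dual_norm_on r (?A k) ?g" for k
  have tH: "infsum t {1..} \<le> hormander_const r K"
    unfolding hormander_const_def t_def
    by (rule SUP_upper2[of "(c, l)"], use l in simp, simp only: case_prod_conv)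
       (rule SUP_upper2[of "(x, z)"], use xz in auto)
  have lpos: "measure lebesgue (?Q k) > 0" for k using l by (simp add: measure_cube)
  have part: "(\<integral>\<^sup>+y\<in>?A k. ennreal (norm (W y)) \<partial>lebesgue) \<le> t k * ennreal ?B" if k: "1 \<le> k" for k
  proof -
    \<comment> \<open>A single term of the series is finite; as \<open>|2\<^sup>kQ| > 0\<close>, so is the dual norm in it.\<close>
    have "t k \<le> infsum t {k}" by simp
    also have "\<dots> \<le> infsum t {1..}"
      by (rule infsum_mono_neutral) (use k in \<open>auto intro: nonneg_summable_on_complete\<close>)
    finally have "t k < \<infinity>" using tH fin by order
    then have dn: "dual_norm_on r (?A k) ?g < \<infinity>"
      using lpos[of k] by (auto simp: t_def ennreal_mult_eq_top_iff ennreal_eq_0_iff not_le less_top[symmetric])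
    have "(\<integral>\<^sup>+y\<in>?A k. ennreal ((\<Prod>i\<in>UNIV. h i (y $ i)) powr r) \<partial>lebesgue)
      \<le> (\<integral>\<^sup>+y. (\<Prod>i\<in>UNIV. ennreal (h i (y $ i) powr r) * indicator (?Q k) (y $ i)) \<partial>lebesgue)"
    proof (rule nn_integral_mono)
      fix y :: "real ^ 'n ^ 'm"
      show "ennreal ((\<Prod>i\<in>UNIV. h i (y $ i)) powr r) * indicator (?A k) y
        \<le> (\<Prod>i\<in>UNIV. ennreal (h i (y $ i) powr r) * indicator (?Q k) (y $ i))"
      proof (cases "y \<in> ?A k")
        case True
        then have "y $ i \<in> ?Q k" for i by (auto simp: annulus_def set_pow_def)
        then show ?thesis using True h(2) by (simp add: prod_ennreal prod_powr_distrib)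
      qed simp
    qed
    also have "\<dots> = (\<Prod>i\<in>UNIV. \<integral>\<^sup>+s\<in>?Q k. ennreal (h i s powr r) \<partial>lebesgue)"
      by (rule nn_integral_prod_vec) measurable
    also have "\<dots> \<le> (\<Prod>i\<in>UNIV. ennreal (measure lebesgue (?Q k) * b i))"
      by (rule prod_mono_ennreal) (use b[OF k] in auto)
    also have "\<dots> = ennreal (measure lebesgue (?Q k) ^ CARD('m) * (\<Prod>i\<in>UNIV. b i))"
      using b0 by (subst prod_ennreal) (auto simp: prod.distrib)
    finally have bb: "(\<integral>\<^sup>+y\<in>?A k. ennreal ((\<Prod>i\<in>UNIV. h i (y $ i)) powr r) \<partial>lebesgue)
      \<le> ennreal (measure lebesgue (?Q k) ^ CARD('m) * (\<Prod>i\<in>UNIV. b i))" .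
    have pb: "0 \<le> (\<Prod>i\<in>UNIV. b i)" using b0 by (intro prod_nonneg) auto
    have "(\<integral>\<^sup>+y\<in>?A k. ennreal (norm (W y)) \<partial>lebesgue)
      \<le> dual_norm_on r (?A k) ?g * ennreal ((measure lebesgue (?Q k) ^ CARD('m) * (\<Prod>i\<in>UNIV. b i)) powr (1 / r))"
    proof (rule nn_integral_le_dual_norm[where g = ?g and W = W, OF r _ W _ _ le bb _ dn])
      show "?A k \<in> sets lebesgue" by (simp add: sets_completionI_sets)
      show "(\<lambda>y. \<Prod>i\<in>UNIV. h i (y $ i)) \<in> borel_measurable lebesgue"
        by (rule borel_imp_lebesgue_measurable) measurable
    qed (use h b0 pb in \<open>auto intro!: prod_nonneg mult_nonneg_nonneg\<close>)
    also have "(measure lebesgue (?Q k) ^ CARD('m) * (\<Prod>i\<in>UNIV. b i)) powr (1 / r)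
        = measure lebesgue (?Q k) powr (?m / r) * ?B"
      using lpos[of k] pb by (simp add: powr_mult powr_realpow[symmetric] powr_powr)
    finally show ?thesis using lpos[of k] by (simp add: t_def ennreal_mult mult_ac)
  qed
  have "(\<integral>\<^sup>+y. ennreal (norm (W y)) \<partial>lebesgue)
    \<le> (\<integral>\<^sup>+y. (\<Sum>k. ennreal (norm (W y)) * indicator (?A (Suc k)) y) \<partial>lebesgue)"
  proof (rule nn_integral_mono)
    fix y :: "real ^ 'n ^ 'm"
    show "ennreal (norm (W y)) \<le> (\<Sum>k. ennreal (norm (W y)) * indicator (?A (Suc k)) y)"
    proof (cases "y \<in> set_pow (cube c l)")
      case True
      then show ?thesis by (simp add: zero)
    next
      case False
      define k where "k = (LEAST k. y \<in> set_pow (?Q k))"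
      have k: "y \<in> set_pow (?Q k)" unfolding k_def using set_pow_cube_exhaust[OF l] by (rule LeastI_ex)
      have "k \<noteq> 0" using k False by (auto intro: ccontr)
      then obtain j where j: "k = Suc j" by (cases k) auto
      have "y \<notin> set_pow (?Q j)" using not_less_Least[of j "\<lambda>k. y \<in> set_pow (?Q k)"] j by (simp add: k_def)
      then have "y \<in> ?A (Suc j)" using k j by (simp add: annulus_def)
      then have "ennreal (norm (W y)) = (\<Sum>k\<in>{j}. ennreal (norm (W y)) * indicator (?A (Suc k)) y)" by simp
      also have "\<dots> \<le> (\<Sum>k. ennreal (norm (W y)) * indicator (?A (Suc k)) y)"
        by (rule sum_le_suminf) auto
      finally show ?thesis .
    qed
  qed
  also have "\<dots> = (\<Sum>k. \<integral>\<^sup>+y\<in>?A (Suc k). ennreal (norm (W y)) \<partial>lebesgue)"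
    by (rule nn_integral_suminf) (auto intro!: borel_measurable_times_ennreal borel_measurable_indicator sets_completionI_sets)
  also have "\<dots> \<le> hormander_const r K * ennreal ?B"
  proof (rule suminf_le_const)
    fix n
    have "(\<Sum>k<n. \<integral>\<^sup>+y\<in>?A (Suc k). ennreal (norm (W y)) \<partial>lebesgue) \<le> (\<Sum>k<n. t (Suc k) * ennreal ?B)"
      by (intro sum_mono part) auto
    also have "\<dots> = (\<Sum>k\<in>Suc ` {..<n}. t k) * ennreal ?B"
      by (simp add: sum_distrib_right sum.reindex)
    also have "(\<Sum>k\<in>Suc ` {..<n}. t k) = infsum t (Suc ` {..<n})" by simp
    also have "\<dots> \<le> infsum t {1..}"
      by (rule infsum_mono_neutral) (auto intro: nonneg_summable_on_complete)
    also note tH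
    finally show "(\<Sum>k<n. \<integral>\<^sup>+y\<in>?A (Suc k). ennreal (norm (W y)) \<partial>lebesgue) \<le> hormander_const r K * ennreal ?B"
      by (simp add: mult_right_mono)
  qed auto
  finally show ?thesis .
qed

section \<open>Truncated functions and the kernel representation\<close>

definition restr :: "'b set \<Rightarrow> ('b \<Rightarrow> 'c) \<Rightarrow> 'b \<Rightarrow> 'c::zero" where
  "restr A f x = (if x \<in> A then f x else 0)"

lemma restr_measurable [measurable]:
  assumes [measurable]: "A \<in> sets M" "f \<in> borel_measurable M" shows "restr A f \<in> borel_measurable M"
  unfolding restr_def by measurable

lemma ess_supp_subset:
  assumes "closed C" "AE x in lebesgue. x \<notin> C \<longrightarrow> f x = 0" shows "ess_supp f \<subseteq> C"
  unfolding ess_supp_def using assms by (auto intro!: exI[of _ "- C"])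

lemma closed_ess_supp: "closed (ess_supp f)"
  unfolding ess_supp_def by (auto simp: closed_def intro!: open_Union)

text \<open>
  The support is the complement of an uncountable union of open sets; by Lindeloef's theorem countably
  many of them suffice, so that the exceptional null sets can be collected.
\<close>

lemma AE_zero_outside_ess_supp: "AE x in lebesgue. x \<notin> ess_supp f \<longrightarrow> f x = 0"
proof -
  let ?U = "{U. open U \<and> (AE x in lebesgue. x \<in> U \<longrightarrow> f x = 0)}"
  obtain V where V: "V \<subseteq> ?U" "countable V" "\<Union>V = \<Union>?U"
    using Lindelof[of ?U] by blast
  have "AE x in lebesgue. \<forall>U\<in>V. x \<in> U \<longrightarrow> f x = 0"
    using V by (subst AE_ball_countable) auto
  then show ?thesis
  proof eventually_elim
    case (elim x)
    then show ?case using V(3) by (auto simp: ess_supp_def)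
  qed
qed

lemma restr_Lspace:
  assumes "f \<in> Lspace r" "A \<in> sets lebesgue" shows "restr A f \<in> Lspace r"
proof -
  have f: "f \<in> borel_measurable lebesgue" "integrable lebesgue (\<lambda>x. norm (f x) powr r)"
    using assms by (auto simp: Lspace_def)
  note [measurable] = f(1) assms(2)
  have "integrable lebesgue (\<lambda>x. norm (restr A f x) powr r)"
    by (rule Bochner_Integration.integrable_bound[OF f(2)]) (auto simp: restr_def)
  then show ?thesis by (simp add: Lspace_def)
qed

lemma compact_ess_supp_restr:
  assumes "bounded A" shows "compact (ess_supp (restr A f))"
proof -
  have "ess_supp (restr A f) \<subseteq> closure A"
    by (rule ess_supp_subset) (use closure_subset[of A] in \<open>auto simp: restr_def\<close>)
  then show ?thesis
    using assms closed_ess_supp compact_closure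
    by (metis bounded_closure bounded_subset compact_eq_bounded_closed)
qed

lemma prod_fun_upd:
  fixes G :: "'m::finite \<Rightarrow> 'b::comm_monoid_mult"
  shows "(\<Prod>i\<in>UNIV. (G(j := a)) i) = a * (\<Prod>i\<in>UNIV - {j}. G i)"
  by (subst prod.remove[of UNIV j]) (auto intro!: prod.cong)

text \<open>
  For \<open>x\<close> inside \<open>B\<close>, the part of \<open>T\<close> coming from outside \<open>B\<^sup>m\<close> is given by the kernel. The
  truncation is changed from \<open>A\<close> to \<open>B\<close> in one argument at a time: by multilinearity each change costs
  \<open>T\<close> at a tuple with one entry that vanishes on \<open>B\<close>. The intersection of the supports then misses \<open>x\<close>,
  and the integral representation applies.
\<close>

lemma kernel_difference:
  fixes T :: "('m::finite \<Rightarrow> real ^ 'n \<Rightarrow> 'a::{real_normed_field, banach, second_countable_topology}) \<Rightarrow> real ^ 'n \<Rightarrow> 'a"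
  assumes T: "singular_integral_operator r T K"
    and f: "\<And>i. f i \<in> Lspace r"
    and AB: "bounded A" "A \<in> sets lebesgue" "B \<in> sets lebesgue" "B \<subseteq> A"
  shows "AE x in lebesgue. x \<in> interior B \<longrightarrow>
      integrable lebesgue (\<lambda>y. K x y * ((\<Prod>i\<in>UNIV. restr A (f i) (y $ i)) - (\<Prod>i\<in>UNIV. restr B (f i) (y $ i)))) \<and>
      T (\<lambda>i. restr A (f i)) x - T (\<lambda>i. restr B (f i)) x =
        (\<integral>y. K x y * ((\<Prod>i\<in>UNIV. restr A (f i) (y $ i)) - (\<Prod>i\<in>UNIV. restr B (f i) (y $ i))) \<partial>lebesgue)"
proof -
  define g where "g J i = (if i \<in> J then restr B (f i) else restr A (f i))" for J i
  let ?D = "\<lambda>x J y. K x y * ((\<Prod>i\<in>UNIV. restr A (f i) (y $ i)) - (\<Prod>i\<in>UNIV. g J i (y $ i)))"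
  have ml: "multilinear_operator r T" using T by (simp add: singular_integral_operator_def)
  have "AE x in lebesgue. x \<in> interior B \<longrightarrow> integrable lebesgue (?D x J) \<and>
      T (\<lambda>i. restr A (f i)) x - T (g J) x = (\<integral>y. ?D x J y \<partial>lebesgue)" for J
  proof (induction J rule: finite_induct[OF finite])
    case 1
    then show ?case by (simp add: g_def)
  next
    case (2 j J)
    define w where "w = restr (A - B) (f j)"
    define h where "h = (g J)(j := w)"
    have gL: "g I i \<in> Lspace r" for I i using f AB by (auto simp: g_def intro: restr_Lspace)
    have wL: "w \<in> Lspace r" unfolding w_def using f AB by (intro restr_Lspace) auto
    have gJ: "g J = (g J)(j := \<lambda>y. restr B (f j) y + w y)"
      using 2 AB by (auto simp: g_def w_def restr_def fun_eq_iff)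
    have gI: "g (insert j J) = (g J)(j := restr B (f j))" by (auto simp: g_def fun_eq_iff)
    have BL: "restr B (f j) \<in> Lspace r" using f AB by (intro restr_Lspace) auto
    have add: "AE x in lebesgue. T (g J) x = T (g (insert j J)) x + T h x"
    proof -
      have "AE x in lebesgue. T ((g J)(j := \<lambda>y. restr B (f j) y + w y)) x
          = T ((g J)(j := restr B (f j))) x + T ((g J)(j := w)) x"
        using ml gL wL BL unfolding multilinear_operator_def by blast
      then show ?thesis using gJ gI by (simp add: h_def)
    qed
    have hL: "h i \<in> Lspace r \<and> compact (ess_supp (h i))" for i
    proof -
      have "bounded B" "bounded (A - B)" using AB bounded_subset by blast+
      then have "compact (ess_supp (h i))" using AB
        by (auto simp: h_def g_def w_def intro!: compact_ess_supp_restr)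
      then show ?thesis using gL wL by (auto simp: h_def)
    qed
    have rep: "AE x in lebesgue. x \<notin> (\<Inter>i. ess_supp (h i)) \<longrightarrow>
        integrable lebesgue (\<lambda>y. K x y * (\<Prod>i\<in>UNIV. h i (y $ i))) \<and>
        T h x = (\<integral>y. K x y * (\<Prod>i\<in>UNIV. h i (y $ i)) \<partial>lebesgue)"
      using T hL unfolding singular_integral_operator_def by blast
    have supp: "ess_supp (h j) \<subseteq> - interior B"
      by (rule ess_supp_subset) (use interior_subset[of B] in \<open>auto simp: h_def w_def restr_def\<close>)
    have diff: "(\<Prod>i\<in>UNIV. g J i (y $ i)) - (\<Prod>i\<in>UNIV. g (insert j J) i (y $ i))
        = (\<Prod>i\<in>UNIV. h i (y $ i))" for y
    proof -
      have 1: "(\<Prod>i\<in>UNIV. g J i (y $ i)) = (\<Prod>i\<in>UNIV. ((\<lambda>i. g J i (y $ i))(j := restr B (f j) (y $ j) + w (y $ j))) i)"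
        by (subst gJ) (auto intro!: prod.cong)
      have 2: "(\<Prod>i\<in>UNIV. g (insert j J) i (y $ i)) = (\<Prod>i\<in>UNIV. ((\<lambda>i. g J i (y $ i))(j := restr B (f j) (y $ j))) i)"
        unfolding gI by (auto intro!: prod.cong)
      have 3: "(\<Prod>i\<in>UNIV. h i (y $ i)) = (\<Prod>i\<in>UNIV. ((\<lambda>i. g J i (y $ i))(j := w (y $ j))) i)"
        unfolding h_def by (auto intro!: prod.cong)
      show ?thesis unfolding 1 2 3 prod_fun_upd by (simp add: algebra_simps)
    qed
    show ?case using rep add 2(3)
    proof eventually_elim
      case (elim x)
      show ?case
      proof
        assume x: "x \<in> interior B"
        then have nx: "x \<notin> (\<Inter>i. ess_supp (h i))" using supp by blast
        have eq: "?D x (insert j J) = (\<lambda>y. ?D x J y + K x y * (\<Prod>i\<in>UNIV. h i (y $ i)))"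
          unfolding diff[symmetric] by (auto simp: algebra_simps)
        have i1: "integrable lebesgue (?D x J)" and i2: "integrable lebesgue (\<lambda>y. K x y * (\<Prod>i\<in>UNIV. h i (y $ i)))"
          using elim x nx by blast+
        have t: "T (\<lambda>i. restr A (f i)) x - T (g (insert j J)) x = T (\<lambda>i. restr A (f i)) x - T (g J) x + T h x"
          using elim by simp
        show "integrable lebesgue (?D x (insert j J)) \<and>
          T (\<lambda>i. restr A (f i)) x - T (g (insert j J)) x = (\<integral>y. ?D x (insert j J) y \<partial>lebesgue)"
          unfolding eq t using i1 i2 elim x nx by (simp add: Bochner_Integration.integral_add)
      qed
    qed
  qed
  from this[of UNIV] have "AE x in lebesgue. x \<in> interior B \<longrightarrow> integrable lebesgue (?D x UNIV) \<and>
      T (\<lambda>i. restr A (f i)) x - T (g UNIV) x = (\<integral>y. ?D x UNIV y \<partial>lebesgue)" .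
  moreover have "g UNIV = (\<lambda>i. restr B (f i))" by (simp add: g_def fun_eq_iff)
  ultimately show ?thesis by (simp only:)
qed

section \<open>The weak type bound\<close>

text \<open>
  The infimum defining the operator norm is attained. The case of a vanishing product of norms is
  separate because one cannot divide by it.
\<close>

lemma weak_norm_le_weak_op_norm:
  fixes T :: "('m::finite \<Rightarrow> real ^ 'n \<Rightarrow> 'a::{real_normed_field, banach, second_countable_topology}) \<Rightarrow> real ^ 'n \<Rightarrow> 'a"
  assumes fin: "weak_op_norm r T < \<infinity>" and f: "\<And>i. f i \<in> Lspace r"
  shows "weak_norm (r / real CARD('m)) (T f) \<le> weak_op_norm r T * ennreal (\<Prod>i\<in>UNIV. Lnorm r (f i))"
proof -
  let ?L = "\<Prod>i\<in>UNIV. Lnorm r (f i)"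
  let ?S = "{C. \<forall>f. (\<forall>i. f i \<in> Lspace r) \<longrightarrow>
      weak_norm (r / real CARD('m)) (T f) \<le> C * ennreal (\<Prod>i\<in>UNIV. Lnorm r (f i))}"
  have L0: "0 \<le> ?L" by (intro prod_nonneg) (simp add: Lnorm_def)
  have le: "weak_norm (r / real CARD('m)) (T f) \<le> C * ennreal ?L" if "C \<in> ?S" for C
    using that f by blast
  show ?thesis
  proof (cases "?L = 0")
    case True
    have "?S \<noteq> {}"
    proof
      assume "?S = {}"
      then have "weak_op_norm r T = Inf {}" unfolding weak_op_norm_def by (rule arg_cong)
      then show False using fin by simp
    qed
    then obtain C where "C \<in> ?S" by blast
    then have "weak_norm (r / real CARD('m)) (T f) \<le> C * ennreal ?L" by (rule le)
    then show ?thesis using True by simp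
  next
    case False
    then obtain l where l: "?L = l" "l > 0" using le_neq_trans[OF L0] by metis
    have "weak_norm (r / real CARD('m)) (T f) / ennreal l \<le> weak_op_norm r T"
      unfolding weak_op_norm_def
    proof (rule Inf_greatest)
      fix C assume "C \<in> ?S"
      from le[OF this, unfolded l(1)] show "weak_norm (r / real CARD('m)) (T f) / ennreal l \<le> C"
        using l by (subst divide_le_posI_ennreal) (auto simp: mult.commute)
    qed
    then have "weak_norm (r / real CARD('m)) (T f) / ennreal l * ennreal l \<le> weak_op_norm r T * ennreal l"
      by (rule mult_right_mono) simp
    moreover have "ennreal l / ennreal l = 1" using l by (intro ennreal_divide_self) auto
    ultimately show ?thesis unfolding l(1) by (simp add: ennreal_divide_times)
  qed
qed

text \<open>
  With \<open>V = |5Q|\<close> and \<open>D\<close> the product of the averages over \<open>5Q\<close> this says that \<open>|T f| > \<kappa> a D\<close> only on a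
  set that is small compared with \<open>Q\<close> once \<open>\<kappa>\<close> is large. If \<open>a D = 0\<close>, then \<open>T f = 0\<close> almost everywhere.
\<close>

lemma weak_type_estimate:
  fixes T :: "('m::finite \<Rightarrow> real ^ 'n \<Rightarrow> 'a::{real_normed_field, banach, second_countable_topology}) \<Rightarrow> real ^ 'n \<Rightarrow> 'a"
  assumes r: "1 \<le> r" and ml: "multilinear_operator r T" and a: "weak_op_norm r T = ennreal a" "0 \<le> a"
    and f: "\<And>i. f i \<in> Lspace r" and k: "0 < \<kappa>" and V: "0 < V" and D: "0 \<le> D"
    and L: "(\<Prod>i\<in>UNIV. Lnorm r (f i)) \<le> V powr (real CARD('m) / r) * D"
  shows "emeasure lebesgue {x. norm (T f x) > \<kappa> * a * D} \<le> ennreal (V * \<kappa> powr (- (r / real CARD('m))))"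
proof -
  define p where "p = real CARD('m) / r"
  have p: "p > 0" using r by (simp add: p_def zero_less_divide_iff)
  have Tm [measurable]: "T f \<in> borel_measurable lebesgue" using ml f by (auto simp: multilinear_operator_def)
  have L0: "0 \<le> (\<Prod>i\<in>UNIV. Lnorm r (f i))" by (intro prod_nonneg) (simp add: Lnorm_def)
  have "weak_norm (r / real CARD('m)) (T f) \<le> ennreal a * ennreal (\<Prod>i\<in>UNIV. Lnorm r (f i))"
    using weak_norm_le_weak_op_norm[of r T f] f a by simp
  also have "\<dots> \<le> ennreal (a * (V powr p * D))"
    using a L L0 by (subst ennreal_mult[symmetric]) (auto simp: p_def intro!: ennreal_leI mult_left_mono)
  finally have wn: "weak_norm (r / real CARD('m)) (T f) \<le> ennreal (a * (V powr p * D))" .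
  have lvl: "ennreal t * ennpowr (emeasure lebesgue {x. norm (T f x) > t}) p \<le> ennreal (a * (V powr p * D))"
    if "t > 0" for t
  proof -
    have "ennreal t * ennpowr (emeasure lebesgue {x. norm (T f x) > t}) (1 / (r / real CARD('m)))
      \<le> weak_norm (r / real CARD('m)) (T f)"
      unfolding weak_norm_def by (rule SUP_upper) (use that in auto)
    then show ?thesis using wn by (simp add: p_def)
  qed
  show ?thesis
  proof (cases "a * D = 0")
    case True
    have "{x. norm (T f x) > 1 / real (Suc n)} \<in> null_sets lebesgue" for n
    proof -
      let ?e = "emeasure lebesgue {x. norm (T f x) > 1 / real (Suc n)}"
      have "a * (V powr p * D) = 0" using True by auto
      moreover have "0 < 1 / real (Suc n)" by simp
      ultimately have "ennreal (1 / real (Suc n)) * ennpowr ?e p = 0"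
        using lvl[of "1 / real (Suc n)"] by (metis ennreal_0 le_zero_eq)
      moreover have "ennreal (1 / real (Suc n)) \<noteq> 0" unfolding ennreal_eq_0_iff by simp
      ultimately have "ennpowr ?e p = 0" by (simp only: mult_eq_0_iff simp_thms)
      then have "enn2real ?e powr p \<le> 0" "?e \<noteq> \<infinity>"
        by (auto simp: ennpowr_def ennreal_eq_0_iff split: if_splits)
      then have "?e = 0" using p by (cases ?e) (auto simp: antisym)
      moreover have "{x \<in> space lebesgue. norm (T f x) > 1 / real (Suc n)} \<in> sets lebesgue" by measurable
      ultimately show ?thesis by (intro null_setsI) simp_all
    qed
    then have "(\<Union>n. {x. norm (T f x) > 1 / real (Suc n)}) \<in> null_sets lebesgue" by blast
    moreover have "{x. norm (T f x) > \<kappa> * a * D} \<subseteq> (\<Union>n. {x. norm (T f x) > 1 / real (Suc n)})"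
    proof
      fix x assume "x \<in> {x. norm (T f x) > \<kappa> * a * D}"
      then have "norm (T f x) > 0" using True by auto
      then obtain n where "inverse (real (Suc n)) < norm (T f x)" using reals_Archimedean by blast
      then show "x \<in> (\<Union>n. {x. norm (T f x) > 1 / real (Suc n)})" by (auto simp: inverse_eq_divide)
    qed
    ultimately have "emeasure lebesgue {x. norm (T f x) > \<kappa> * a * D} = 0"
      by (metis emeasure_mono le_zero_eq null_setsD1 null_setsD2)
    then show ?thesis by simp
  next
    case False
    then have aD: "a * D > 0" using a D by (simp add: less_le)
    define t where "t = \<kappa> * a * D"
    have t: "t > 0" using aD k by (simp add: t_def mult.assoc)
    let ?e = "emeasure lebesgue {x. norm (T f x) > t}"
    have "?e \<noteq> \<infinity>"
    proof
      assume "?e = \<infinity>"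
      then show False using lvl[OF t] t by (simp add: ennpowr_def ennreal_mult_top top_unique)
    qed
    then obtain e where e: "?e = ennreal e" "0 \<le> e" by (cases ?e) auto
    have "ennreal (t * e powr p) \<le> ennreal (a * (V powr p * D))"
      using lvl[OF t] t e by (simp add: ennpowr_def ennreal_mult)
    then have "t * e powr p \<le> a * (V powr p * D)" using a D by (subst (asm) ennreal_le_iff) auto
    then have "(a * D) * (\<kappa> * e powr p) \<le> (a * D) * V powr p" by (simp add: t_def mult_ac)
    then have "\<kappa> * e powr p \<le> V powr p" using aD by (simp only: mult_le_cancel_left_pos)
    then have "e powr p \<le> V powr p * \<kappa> powr - 1" using k by (simp add: powr_minus field_simps)
    then have "(e powr p) powr (1 / p) \<le> (V powr p * \<kappa> powr - 1) powr (1 / p)"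
      using p by (intro powr_mono2) auto
    also have "(V powr p * \<kappa> powr - 1) powr (1 / p) = V powr (p * (1 / p)) * \<kappa> powr (- 1 * (1 / p))"
      unfolding powr_powr[symmetric] by (rule powr_mult)
    finally have "e \<le> V * \<kappa> powr (- (1 / p))" using p e V by (simp add: powr_powr)
    then show ?thesis using e by (simp add: t_def[symmetric] p_def ennreal_leI)
  qed
qed

section \<open>The dyadic maximal estimate and stopping cells\<close>

lemma dilate_5_subset_neighbours:
  "dilate 5 q \<subseteq> (\<Union>p\<in>{p. fst p = fst q \<and> (\<forall>j. \<bar>snd p $ j - snd q $ j\<bar> \<le> 3)}. cell p)"
proof
  fix x assume x: "x \<in> dilate 5 q"
  let ?p = "cell_at (fst q) x"
  have s: "side ?p = side q" by (simp add: side_def)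
  have "\<bar>snd ?p $ j - snd q $ j\<bar> \<le> 3" for j
  proof -
    let ?v = "real_of_int (snd q $ j)" and ?w = "real_of_int (snd ?p $ j)"
    have 1: "\<bar>x $ j - side q * (?v + 1 / 2)\<bar> \<le> 5 * side q / 2"
      using x by (simp add: mem_dilate center_def)
    have 2: "side q * ?w \<le> x $ j" "x $ j < side q * (?w + 1)"
      using mem_cell_at[of x "fst q"] unfolding mem_cell_bounds s by auto
    have "side q * ?w \<le> side q * (?v + 3)"
      using 1[unfolded abs_le_iff] 2 by (simp add: algebra_simps)
    moreover have "side q * (?v - 2) < side q * (?w + 1)"
      using 1[unfolded abs_le_iff] 2 by (simp add: algebra_simps)
    ultimately have "?w \<le> ?v + 3" "?v - 2 < ?w + 1" by (simp_all only: mult_le_cancel_left_pos mult_less_cancel_left_pos side_pos)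
    then show ?thesis by linarith
  qed
  then show "x \<in> (\<Union>p\<in>{p. fst p = fst q \<and> (\<forall>j. \<bar>snd p $ j - snd q $ j\<bar> \<le> 3)}. cell p)"
    using mem_cell_at[of x "fst q"] by (intro UN_I[of ?p]) auto
qed

lemma neighbour_dilate_7:
  assumes "fst p = fst q" "\<And>j. \<bar>snd p $ j - snd q $ j\<bar> \<le> 3"
  shows "cell p \<subseteq> dilate 7 q"
proof
  fix x assume x: "x \<in> cell p"
  have s: "side p = side q" using assms by (simp add: side_def)
  show "x \<in> dilate 7 q" unfolding mem_dilate
  proof
    fix j
    let ?v = "real_of_int (snd q $ j)" and ?w = "real_of_int (snd p $ j)"
    have "\<bar>?w - ?v\<bar> \<le> 3" using assms(2)[of j] by linarith
    then have "side q * \<bar>?w - ?v\<bar> \<le> side q * 3" by (intro mult_left_mono) auto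
    then have "\<bar>side q * (?w - ?v)\<bar> \<le> side q * 3" by (simp add: abs_mult)
    then have "\<bar>center p $ j - center q $ j\<bar> \<le> 3 * side q" by (simp add: center_def s algebra_simps)
    moreover have "\<bar>x $ j - center p $ j\<bar> \<le> side q / 2" using mem_cell_center[OF x] s by simp
    ultimately show "\<bar>x $ j - center q $ j\<bar> \<le> 7 * side q / 2" by linarith
  qed
qed

lemma cells_same_level_disjoint: "disjoint_family_on cell {p. fst p = k \<and> P p}"
proof -
  have "p = q" if "fst p = k" "fst q = k" "x \<in> cell p" "x \<in> cell q" for p q and x :: "real ^ 'a"
    using cell_common_ancestor[of x p q] that by simp
  then show ?thesis unfolding disjoint_family_on_def by blast
qed

text \<open>
  The weak \<open>(1,1)\<close> bound for a dyadic maximal function over fivefold dilates. A large integral over \<open>5q\<close>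
  forces a large integral over one of the \<open>7\<^sup>n\<close> neighbouring cells of the same size that cover \<open>5q\<close>. So
  \<open>q\<close> lies in the sevenfold dilate of a cell with large average, and then in that of a maximal such
  cell; maximal cells are disjoint, and no covering lemma for balls is involved.
\<close>

lemma dyadic_maximal_estimate:
  fixes g :: "real ^ 'n \<Rightarrow> ennreal"
  assumes g: "g \<in> borel_measurable lebesgue" and l: "0 < \<tau>"
  shows "emeasure lebesgue (\<Union>q\<in>{q. fst q \<le> k0 \<and>
      (\<integral>\<^sup>+t\<in>dilate 5 q. g t \<partial>lebesgue) > ennreal (\<tau> * (7 * side q) ^ CARD('n))}. cell q)
    \<le> ennreal (7 ^ CARD('n) / \<tau>) * (\<integral>\<^sup>+t. g t \<partial>lebesgue)"
proof -
  note [measurable] = g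
  let ?I = "{q :: int \<times> (int ^ 'n). fst q \<le> k0 \<and>
      (\<integral>\<^sup>+t\<in>dilate 5 q. g t \<partial>lebesgue) > ennreal (\<tau> * (7 * side q) ^ CARD('n))}"
  let ?nu = "density lebesgue g"
  have nu: "emeasure ?nu A = (\<integral>\<^sup>+t\<in>A. g t \<partial>lebesgue)" if "A \<in> sets lebesgue" for A
    using that by (simp add: emeasure_density)
  define B where "B = {p :: int \<times> (int ^ 'n). fst p \<le> k0 \<and> ennreal (\<tau> * side p ^ CARD('n)) < emeasure ?nu (cell p)}"
  have near: "\<exists>p\<in>maximal_cells B. cell q \<subseteq> dilate 7 p" if q: "q \<in> ?I" for q
  proof -
    let ?N = "{p. fst p = fst q \<and> (\<forall>j. \<bar>snd p $ j - snd q $ j\<bar> \<le> 3)}"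
    have "\<exists>p\<in>?N. ennreal \<tau> * emeasure lebesgue (cell p) < emeasure ?nu (cell p)"
    proof (rule ccontr)
      assume none: "\<not> (\<exists>p\<in>?N. ennreal \<tau> * emeasure lebesgue (cell p) < emeasure ?nu (cell p))"
      have le: "emeasure ?nu (cell p) \<le> ennreal \<tau> * emeasure lebesgue (cell p)" if "p \<in> ?N" for p
        using that none by (meson not_less)
      have "emeasure ?nu (dilate 5 q) \<le> emeasure ?nu (\<Union>p\<in>?N. cell p)"
        by (rule emeasure_mono[OF dilate_5_subset_neighbours]) auto
      also have "\<dots> \<le> ennreal \<tau> * emeasure lebesgue (\<Union>p\<in>?N. cell p)"
        by (rule emeasure_UN_le_scaled) (use le cells_same_level_disjoint in auto)
      also have "\<dots> \<le> ennreal \<tau> * emeasure lebesgue (dilate 7 q)"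
      proof (intro mult_left_mono emeasure_mono UN_least)
        fix p assume "p \<in> ?N"
        then show "cell p \<subseteq> dilate 7 q" by (intro neighbour_dilate_7) simp_all
      qed auto
      also have "\<dots> = ennreal (\<tau> * (7 * side q) ^ CARD('n))"
        using l by (simp add: emeasure_dilate ennreal_mult)
      finally show False using q by (simp add: nu not_le[symmetric])
    qed
    then obtain p where p: "p \<in> ?N" "ennreal \<tau> * emeasure lebesgue (cell p) < emeasure ?nu (cell p)" by blast
    then have "p \<in> B" using q l by (simp add: B_def emeasure_cell ennreal_mult)
    then obtain i where i: "ancestor i p \<in> maximal_cells B"
      using maximal_cells_cover[of B k0 p] by (auto simp: B_def)
    have "cell q \<subseteq> dilate 7 p" by (rule neighbour_dilate_7) (use p in \<open>auto simp: abs_minus_commute\<close>)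
    also have "\<dots> \<subseteq> dilate 7 (ancestor i p)" by (rule dilate_mono_ancestor) simp
    finally show ?thesis using i by blast
  qed
  have "emeasure lebesgue (\<Union>q\<in>?I. cell q) \<le> emeasure lebesgue (\<Union>p\<in>maximal_cells B. dilate 7 p)"
    by (rule emeasure_mono) (use near in \<open>blast, auto\<close>)
  also have "\<dots> \<le> ennreal (7 ^ CARD('n) / \<tau>) * emeasure ?nu (\<Union>p\<in>maximal_cells B. cell p)"
  proof (rule emeasure_UN_le_scaled)
    fix p assume "p \<in> maximal_cells B"
    then have "ennreal (\<tau> * side p ^ CARD('n)) < emeasure ?nu (cell p)"
      using maximal_cells_subset by (auto simp: B_def)
    then have "ennreal (7 ^ CARD('n) / \<tau>) * ennreal (\<tau> * side p ^ CARD('n)) \<le> ennreal (7 ^ CARD('n) / \<tau>) * emeasure ?nu (cell p)"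
      by (intro mult_left_mono) auto
    moreover have "ennreal (7 ^ CARD('n) / \<tau>) * ennreal (\<tau> * side p ^ CARD('n)) = emeasure lebesgue (dilate 7 p)"
      using l by (simp add: emeasure_dilate ennreal_mult[symmetric] power_mult_distrib)
    ultimately show "emeasure lebesgue (dilate 7 p) \<le> ennreal (7 ^ CARD('n) / \<tau>) * emeasure ?nu (cell p)" by simp
  qed (auto simp: maximal_cells_disjoint)
  also have "\<dots> \<le> ennreal (7 ^ CARD('n) / \<tau>) * emeasure ?nu UNIV"
    by (intro mult_left_mono emeasure_mono) auto
  finally show ?thesis by (simp add: nu)
qed

text \<open>
  A Calderon-Zygmund decomposition of \<open>G\<close> inside \<open>Q\<close>: take the maximal cells in which \<open>G\<close> has density
  above \<open>2\<^bsup>-n-1\<^esup>\<close>. The parent of a selected cell is not selected, which bounds the density of \<open>G\<close> in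
  the cell itself by \<open>2\<^sup>n \<cdot> 2\<^bsup>-n-1\<^esup> = 1/2\<close>. As \<open>G\<close> is a union of small cells, it is covered completely,
  without an appeal to Lebesgue's density theorem.
\<close>

lemma stopping_cells:
  fixes Q :: "int \<times> (int ^ 'n)"
  assumes G: "G \<in> sets lebesgue" and small: "emeasure lebesgue G \<le> ennreal (side Q ^ CARD('n) / 2 ^ (CARD('n) + 2))"
    and cells: "\<And>x. x \<in> G \<Longrightarrow> \<exists>p. fst p \<le> fst Q \<and> x \<in> cell p \<and> cell p \<subseteq> G"
  obtains C where "\<And>P. P \<in> C \<Longrightarrow> cell P \<subseteq> cell Q" "disjoint_family_on cell C"
    "2 * emeasure lebesgue (\<Union>P\<in>C. cell P) \<le> emeasure lebesgue (cell Q)"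
    "cell Q \<inter> G \<subseteq> (\<Union>P\<in>C. cell P)"
    "\<And>P. P \<in> C \<Longrightarrow> emeasure lebesgue (cell P \<inter> G) \<le> ennreal (side P ^ CARD('n) / 2)"
proof -
  let ?m = "emeasure lebesgue" and ?n = "CARD('n)"
  define B where "B = {P. cell P \<subseteq> cell Q \<and> ?m (cell P \<inter> G) > ennreal (side P ^ ?n / 2 ^ (?n + 1))}"
  have Q: "Q \<notin> B"
  proof
    assume "Q \<in> B"
    then have "ennreal (side Q ^ ?n / 2 ^ (?n + 1)) < ?m (cell Q \<inter> G)" by (simp add: B_def)
    also have "\<dots> \<le> ?m G" by (rule emeasure_mono) (use G in auto)
    also note small
    finally show False by (subst (asm) ennreal_less_iff) (auto simp: field_simps)
  qed
  show ?thesis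
  proof (rule that[of "maximal_cells B"])
    show "cell P \<subseteq> cell Q" if "P \<in> maximal_cells B" for P
      using that maximal_cells_subset[of B] by (auto simp: B_def)
    show "disjoint_family_on cell (maximal_cells B)" by (rule maximal_cells_disjoint)
    have "?m (\<Union>P\<in>maximal_cells B. cell P) \<le> ennreal (2 ^ (?n + 1)) * ?m (\<Union>P\<in>maximal_cells B. cell P \<inter> G)"
    proof (rule emeasure_UN_le_scaled)
      show "disjoint_family_on (\<lambda>P. cell P \<inter> G) (maximal_cells B)"
        using maximal_cells_disjoint[of B] unfolding disjoint_family_on_def by blast
      fix P assume "P \<in> maximal_cells B"
      then have "ennreal (side P ^ ?n / 2 ^ (?n + 1)) \<le> ?m (cell P \<inter> G)"
        using maximal_cells_subset[of B] by (auto simp: B_def)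
      then have "ennreal (2 ^ (?n + 1)) * ennreal (side P ^ ?n / 2 ^ (?n + 1)) \<le> ennreal (2 ^ (?n + 1)) * ?m (cell P \<inter> G)"
        by (intro mult_left_mono) auto
      moreover have "ennreal (2 ^ (?n + 1)) * ennreal (side P ^ ?n / 2 ^ (?n + 1)) = ?m (cell P)"
        by (subst ennreal_mult[symmetric]) (auto simp: emeasure_cell)
      ultimately show "?m (cell P) \<le> ennreal (2 ^ (?n + 1)) * ?m (cell P \<inter> G)" by simp
    qed (use G in auto)
    also have "\<dots> \<le> ennreal (2 ^ (?n + 1)) * ?m G"
      by (intro mult_left_mono emeasure_mono) (use G in auto)
    also have "\<dots> \<le> ennreal (2 ^ (?n + 1)) * ennreal (side Q ^ ?n / 2 ^ (?n + 2))"
      by (intro mult_left_mono small) auto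
    also have "\<dots> = ennreal (side Q ^ ?n / 2)"
      by (subst ennreal_mult[symmetric]) (auto simp: field_simps)
    finally have "2 * ?m (\<Union>P\<in>maximal_cells B. cell P) \<le> 2 * ennreal (side Q ^ ?n / 2)"
      by (intro mult_left_mono) auto
    also have "\<dots> = ?m (cell Q)"
      unfolding ennreal_numeral[symmetric] by (subst ennreal_mult[symmetric]) (auto simp: emeasure_cell)
    finally show "2 * ?m (\<Union>P\<in>maximal_cells B. cell P) \<le> ?m (cell Q)" .
    show "cell Q \<inter> G \<subseteq> (\<Union>P\<in>maximal_cells B. cell P)"
    proof
      fix x assume x: "x \<in> cell Q \<inter> G"
      then obtain p where p: "fst p \<le> fst Q" "x \<in> cell p" "cell p \<subseteq> G" using cells by blast
      have sub: "cell p \<subseteq> cell Q" using cell_nested[of x p Q] p x by blast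
      have pos: "side p ^ ?n > 0" by simp
      have "(2 :: real) ^ (?n + 1) > 1" by (rule one_less_power) auto
      then have "side p ^ ?n / 2 ^ (?n + 1) < side p ^ ?n"
        using pos by (simp add: divide_less_eq del: side_pos power_Suc)
      then have "p \<in> B" using sub p(3) by (simp add: B_def Int_absorb2 emeasure_cell ennreal_less_iff)
      moreover have "fst q \<le> fst Q" if "q \<in> B" for q
        using that unfolding B_def by (intro cell_subsetD) simp
      ultimately obtain i where "ancestor i p \<in> maximal_cells B"
        using maximal_cells_cover[of B "fst Q" p] by metis
      then show "x \<in> (\<Union>P\<in>maximal_cells B. cell P)" using p cell_subset_ancestor by blast
    qed
    show "?m (cell P \<inter> G) \<le> ennreal (side P ^ ?n / 2)" if P: "P \<in> maximal_cells B" for P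
    proof -
      have PB: "P \<in> B" using P maximal_cells_subset by blast
      then have "cell P \<subseteq> cell Q" by (simp add: B_def)
      then obtain i where i: "Q = ancestor i P" by (rule cell_subset_obtains)
      have "i \<noteq> 0" using i Q PB by (metis ancestor_0)
      then obtain d where d: "i = d + 1" by (metis Suc_eq_plus1 not0_implies_Suc)
      let ?P = "ancestor 1 P"
      have "cell ?P \<subseteq> cell Q" using i d ancestor_ancestor[of d 1 P] cell_subset_ancestor[of ?P d] by simp
      moreover have "?P \<notin> B" using P by (simp add: maximal_cells_def)
      ultimately have "?m (cell ?P \<inter> G) \<le> ennreal (side ?P ^ ?n / 2 ^ (?n + 1))" by (simp add: B_def not_less)
      also have "side ?P ^ ?n / 2 ^ (?n + 1) = side P ^ ?n / 2" by (simp add: side_ancestor power_mult_distrib)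
      finally have "?m (cell ?P \<inter> G) \<le> ennreal (side P ^ ?n / 2)" .
      moreover have "?m (cell P \<inter> G) \<le> ?m (cell ?P \<inter> G)"
        by (rule emeasure_mono) (use G cell_subset_ancestor[of P 1] in auto)
      ultimately show ?thesis by order
    qed
  qed
qed

section \<open>The one-step estimate for the operator\<close>

definition avg :: "real \<Rightarrow> (real ^ 'n \<Rightarrow> 'a::{real_normed_field, banach, second_countable_topology}) \<Rightarrow> int \<times> (int ^ 'n) \<Rightarrow> real" where
  "avg r f Q = 1 / measure lebesgue (dilate 5 Q) * (LINT y:dilate 5 Q|lebesgue. norm (f y) powr r)"

definition prod_avg :: "real \<Rightarrow> ('m::finite \<Rightarrow> real ^ 'n \<Rightarrow> 'a::{real_normed_field, banach, second_countable_topology}) \<Rightarrow> int \<times> (int ^ 'n) \<Rightarrow> real" where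
  "prod_avg r f Q = (\<Prod>i\<in>UNIV. avg r (f i) Q powr (1 / r))"

lemma avg_nonneg: "0 \<le> avg r f Q"
  unfolding avg_def set_lebesgue_integral_def by (intro mult_nonneg_nonneg integral_nonneg_AE) auto

lemma prod_avg_nonneg: "0 \<le> prod_avg r f Q"
  unfolding prod_avg_def by (intro prod_nonneg) auto

lemma integral_restr_dilate:
  fixes f :: "real ^ 'n \<Rightarrow> 'a::{real_normed_field, banach, second_countable_topology}"
  assumes "f \<in> Lspace r"
  shows "(\<integral>t. norm (restr (dilate 5 Q) f t) powr r \<partial>lebesgue) = avg r f Q * (5 * side Q) ^ CARD('n)"
    and "(\<integral>\<^sup>+t. ennreal (norm (restr (dilate 5 Q) f t) powr r) \<partial>lebesgue) = ennreal (avg r f Q * (5 * side Q) ^ CARD('n))"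
proof -
  have "(\<integral>t. norm (restr (dilate 5 Q) f t) powr r \<partial>lebesgue) = (LINT y:dilate 5 Q|lebesgue. norm (f y) powr r)"
    unfolding set_lebesgue_integral_def by (intro Bochner_Integration.integral_cong) (auto simp: restr_def)
  moreover have "(5 * side Q) ^ CARD('n) > 0" by simp
  ultimately show 1: "(\<integral>t. norm (restr (dilate 5 Q) f t) powr r \<partial>lebesgue) = avg r f Q * (5 * side Q) ^ CARD('n)"
    by (simp add: avg_def measure_dilate)
  have "restr (dilate 5 Q) f \<in> Lspace r" using assms by (rule restr_Lspace) simp
  then have "integrable lebesgue (\<lambda>t. norm (restr (dilate 5 Q) f t) powr r)" by (simp add: Lspace_def)
  from nn_integral_eq_integral[OF this]
  show "(\<integral>\<^sup>+t. ennreal (norm (restr (dilate 5 Q) f t) powr r) \<partial>lebesgue) = ennreal (avg r f Q * (5 * side Q) ^ CARD('n))"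
    by (simp add: 1)
qed

lemma local_weak_type:
  fixes T :: "('m::finite \<Rightarrow> real ^ 'n \<Rightarrow> 'a::{real_normed_field, banach, second_countable_topology}) \<Rightarrow> real ^ 'n \<Rightarrow> 'a"
  assumes r: "1 \<le> r" and ml: "multilinear_operator r T" and a: "weak_op_norm r T = ennreal a" "0 \<le> a"
    and f: "\<And>i. f i \<in> Lspace r" and k: "0 < \<kappa>"
  shows "emeasure lebesgue {x. norm (T (\<lambda>i. restr (dilate 5 Q) (f i)) x) > \<kappa> * a * prod_avg r f Q}
    \<le> ennreal ((5 * side Q) ^ CARD('n) * \<kappa> powr (- (r / real CARD('m))))"
proof (rule weak_type_estimate[OF r ml a _ k])
  let ?V = "(5 * side Q) ^ CARD('n)"
  show V: "0 < ?V" by simp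
  show "restr (dilate 5 Q) (f i) \<in> Lspace r" for i using f by (rule restr_Lspace) simp
  have "Lnorm r (restr (dilate 5 Q) (f i)) = ?V powr (1 / r) * avg r (f i) Q powr (1 / r)" for i
    unfolding Lnorm_def integral_restr_dilate(1)[OF f] by (simp add: powr_mult mult.commute)
  then have "(\<Prod>i\<in>UNIV. Lnorm r (restr (dilate 5 Q) (f i))) = (?V powr (1 / r)) ^ CARD('m) * prod_avg r f Q"
    by (simp add: prod.distrib prod_avg_def)
  also have "(?V powr (1 / r)) ^ CARD('m) = ?V powr (real CARD('m) / r)"
    using V by (simp add: powr_realpow[symmetric] powr_powr)
  finally show "(\<Prod>i\<in>UNIV. Lnorm r (restr (dilate 5 Q) (f i))) \<le> ?V powr (real CARD('m) / r) * prod_avg r f Q" by simp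
qed (rule prod_avg_nonneg)

text \<open>
  The set where some maximal function of \<open>|f\<^sub>i|\<^sup>r\<close>, truncated to \<open>5Q\<close>, exceeds a multiple
  of its average over \<open>5Q\<close>. Restricting to cells up to the level of \<open>Q\<close> keeps the cells bounded in
  size; larger cells obey the bound automatically (lemma \<open>averages_outside_high_avg\<close>).
\<close>

definition high_avg :: "real \<Rightarrow> real \<Rightarrow> ('m \<Rightarrow> real ^ 'n \<Rightarrow> 'a::{real_normed_field, banach, second_countable_topology})
    \<Rightarrow> int \<times> (int ^ 'n) \<Rightarrow> (real ^ 'n) set" where
  "high_avg \<Lambda> r f Q = (\<Union>i. \<Union>q\<in>{q. fst q \<le> fst Q \<and>
      (\<integral>\<^sup>+t\<in>dilate 5 q. ennreal (norm (restr (dilate 5 Q) (f i) t) powr r) \<partial>lebesgue)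
        > ennreal (\<Lambda> * avg r (f i) Q * side q ^ CARD('n))}. cell q)"

lemma high_avg_measurable: 
  fixes f :: "'m::finite \<Rightarrow> real ^ 'n \<Rightarrow> 'a::{real_normed_field, banach, second_countable_topology}"
  shows "high_avg \<Lambda> r f Q \<in> sets lebesgue"
  unfolding high_avg_def by (intro sets.countable_UN' sets.finite_UN) auto

text \<open>
  The constant is \<open>245 = 7 \<cdot> 7 \<cdot> 5\<close>: one factor \<open>7\<close> for the neighbouring cells, one for the dilates of the
  maximal cells, and \<open>5\<close> from \<open>|5Q|\<close> in the average.
\<close>

lemma emeasure_high_avg:
  fixes f :: "'m::finite \<Rightarrow> real ^ 'n \<Rightarrow> 'a::{real_normed_field, banach, second_countable_topology}"
  assumes f: "\<And>i. f i \<in> Lspace r" and L: "0 < \<Lambda>"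
  shows "emeasure lebesgue (high_avg \<Lambda> r f Q) \<le> ennreal (real CARD('m) * ((245 * side Q) ^ CARD('n) / \<Lambda>))"
proof -
  let ?g = "\<lambda>i t. ennreal (norm (restr (dilate 5 Q) (f i) t) powr r)"
  let ?I = "\<lambda>i. {q. fst q \<le> fst Q \<and> (\<integral>\<^sup>+t\<in>dilate 5 q. ?g i t \<partial>lebesgue) > ennreal (\<Lambda> * avg r (f i) Q * side q ^ CARD('n))}"
  have one: "emeasure lebesgue (\<Union>q\<in>?I i. cell q) \<le> ennreal ((245 * side Q) ^ CARD('n) / \<Lambda>)" for i
  proof (cases "avg r (f i) Q = 0")
    case True
    have "(\<integral>\<^sup>+t\<in>dilate 5 q. ?g i t \<partial>lebesgue) \<le> (\<integral>\<^sup>+t. ?g i t \<partial>lebesgue)" for q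
      by (intro nn_integral_mono) (auto simp: indicator_def)
    then have "(\<integral>\<^sup>+t\<in>dilate 5 q. ?g i t \<partial>lebesgue) = 0" for q
      using integral_restr_dilate(2)[OF f, of Q i] True by (simp add: le_zero_eq)
    then have e: "?I i = {}" by auto
    show ?thesis unfolding e by simp
  next
    case False
    then have A: "avg r (f i) Q > 0" using avg_nonneg[of r "f i" Q] by simp
    \<comment> \<open>With this \<open>\<tau>\<close> the threshold of the maximal estimate is the one that defines the index set.\<close>
    define \<tau> where "\<tau> = \<Lambda> * avg r (f i) Q / 7 ^ CARD('n)"
    have \<tau>: "\<tau> > 0" using A L by (simp add: \<tau>_def)
    have eq: "\<tau> * (7 * s) ^ CARD('n) = \<Lambda> * avg r (f i) Q * s ^ CARD('n)" for s
      by (simp add: \<tau>_def power_mult_distrib)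
    have "restr (dilate 5 Q) (f i) \<in> borel_measurable lebesgue"
      using restr_Lspace[OF f[of i], of "dilate 5 Q"] by (simp add: Lspace_def)
    then have "?g i \<in> borel_measurable lebesgue" by measurable
    from dyadic_maximal_estimate[OF this \<tau>, of "fst Q"]
    have "emeasure lebesgue (\<Union>q\<in>?I i. cell q) \<le> ennreal (7 ^ CARD('n) / \<tau>) * ennreal (avg r (f i) Q * (5 * side Q) ^ CARD('n))"
      unfolding eq integral_restr_dilate(2)[OF f] .
    also have "\<dots> = ennreal ((7 ^ CARD('n) / \<tau>) * (avg r (f i) Q * (5 * side Q) ^ CARD('n)))"
      using \<tau> A by (subst ennreal_mult) auto
    also have "(7 ^ CARD('n) / \<tau>) * (avg r (f i) Q * (5 * side Q) ^ CARD('n)) = (245 * side Q) ^ CARD('n) / \<Lambda>"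
    proof -
      have "(7 ^ CARD('n) / \<tau>) * (avg r (f i) Q * (5 * side Q) ^ CARD('n)) = (7 ^ CARD('n) * 7 ^ CARD('n) * (5 * side Q) ^ CARD('n)) / \<Lambda>"
        using A L by (simp add: \<tau>_def)
      also have "7 ^ CARD('n) * 7 ^ CARD('n) * (5 * side Q) ^ CARD('n) = (7 * 7 * (5 * side Q)) ^ CARD('n)"
        by (simp only: power_mult_distrib)
      also have "7 * 7 * (5 * side Q) = 245 * side Q" by simp
      finally show ?thesis .
    qed
    finally show ?thesis .
  qed
  have "emeasure lebesgue (high_avg \<Lambda> r f Q) \<le> (\<Sum>i\<in>UNIV. emeasure lebesgue (\<Union>q\<in>?I i. cell q))"
    unfolding high_avg_def by (rule emeasure_subadditive_finite) (auto intro!: sets.countable_UN')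
  also have "\<dots> \<le> (\<Sum>i\<in>(UNIV :: 'm set). ennreal ((245 * side Q) ^ CARD('n) / \<Lambda>))" by (intro sum_mono one)
  also have "\<dots> = ennreal (real CARD('m) * ((245 * side Q) ^ CARD('n) / \<Lambda>))"
    using L by (subst sum_ennreal) auto
  finally show ?thesis .
qed

lemma averages_outside_high_avg:
  fixes f :: "'m::finite \<Rightarrow> real ^ 'n \<Rightarrow> 'a::{real_normed_field, banach, second_countable_topology}"
  assumes f: "\<And>i. f i \<in> Lspace r" and L: "5 ^ CARD('n) \<le> \<Lambda>" and z: "z \<notin> high_avg \<Lambda> r f Q" "z \<in> cell R"
  shows "(\<integral>\<^sup>+t\<in>dilate 5 R. ennreal (norm (restr (dilate 5 Q) (f i) t) powr r) \<partial>lebesgue)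
      \<le> ennreal (\<Lambda> * avg r (f i) Q * side R ^ CARD('n))"
proof (cases "fst R \<le> fst Q")
  case True
  show ?thesis
  proof (rule ccontr)
    assume "\<not> ?thesis"
    with True have "R \<in> {q. fst q \<le> fst Q \<and>
      (\<integral>\<^sup>+t\<in>dilate 5 q. ennreal (norm (restr (dilate 5 Q) (f i) t) powr r) \<partial>lebesgue)
        > ennreal (\<Lambda> * avg r (f i) Q * side q ^ CARD('n))}" by (simp add: not_le)
    then have "z \<in> high_avg \<Lambda> r f Q" unfolding high_avg_def using z(2) by blast
    then show False using z(1) by simp
  qed
next
  case False
  have "(\<integral>\<^sup>+t\<in>dilate 5 R. ennreal (norm (restr (dilate 5 Q) (f i) t) powr r) \<partial>lebesgue)
    \<le> (\<integral>\<^sup>+t. ennreal (norm (restr (dilate 5 Q) (f i) t) powr r) \<partial>lebesgue)"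
    by (intro nn_integral_mono) (auto simp: indicator_def)
  also have "\<dots> = ennreal (5 ^ CARD('n) * avg r (f i) Q * side Q ^ CARD('n))"
    unfolding integral_restr_dilate(2)[OF f] by (simp add: power_mult_distrib mult_ac)
  also have "\<dots> \<le> ennreal (\<Lambda> * avg r (f i) Q * side R ^ CARD('n))"
    using False L avg_nonneg[of r "f i" Q]
    by (intro ennreal_leI mult_mono power_mono side_mono mult_nonneg_nonneg) (auto intro: order_trans[OF _ L])
  finally show ?thesis .
qed

text \<open>
  The kernel part of \<open>T\<close> oscillates little on \<open>P\<close>. The Hoermander condition is applied to the cube \<open>2P\<close>,
  whose half is \<open>P\<close>, and the functions vanish on \<open>(5P)\<^sup>m\<close>, which contains \<open>(2P)\<^sup>m\<close>. The cubes \<open>2\<^sup>k(2P)\<close> have the size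
  of the ancestor \<open>R\<close> of \<open>P\<close> that is \<open>k + 1\<close> levels up and are contained in \<open>5R\<close>, so that bounds for
  averages over dilates of dyadic cells around \<open>z\<close> suffice.
\<close>

lemma kernel_oscillation:
  fixes K :: "real ^ 'n \<Rightarrow> real ^ 'n ^ 'm \<Rightarrow> 'a::{real_normed_field, banach, second_countable_topology}"
  assumes r: "1 \<le> r" and H: "hormander_const r K = ennreal h" "0 \<le> h"
    and f: "\<And>i. f i \<in> borel_measurable borel" and PQ: "cell P \<subseteq> cell Q"
    and xz: "x \<in> cell P" "z \<in> cell P" and b0: "\<And>i. 0 \<le> b i"
    and b: "\<And>R i. z \<in> cell R \<Longrightarrow> (\<integral>\<^sup>+t\<in>dilate 5 R. ennreal (norm (restr (dilate 5 Q) (f i) t) powr r) \<partial>lebesgue)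
        \<le> ennreal (b i * side R ^ CARD('n))"
  defines "\<Phi> \<equiv> \<lambda>y :: real ^ 'n ^ 'm. (\<Prod>i\<in>UNIV. restr (dilate 5 Q) (f i) (y $ i)) - (\<Prod>i\<in>UNIV. restr (dilate 5 P) (f i) (y $ i))"
  assumes ix: "integrable lebesgue (\<lambda>y. K x y * \<Phi> y)" and iz: "integrable lebesgue (\<lambda>y. K z y * \<Phi> y)"
  shows "norm ((\<integral>y. K x y * \<Phi> y \<partial>lebesgue) - (\<integral>y. K z y * \<Phi> y \<partial>lebesgue)) \<le> h * (\<Prod>i\<in>UNIV. b i) powr (1 / r)"
proof -
  define W where "W y = (K x y - K z y) * \<Phi> y" for y
  have W_eq: "W = (\<lambda>y. K x y * \<Phi> y - K z y * \<Phi> y)" by (simp add: W_def fun_eq_iff left_diff_distrib)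
  have Wint: "integrable lebesgue W" unfolding W_eq using ix iz by (rule Bochner_Integration.integrable_diff)
  have sub: "dilate 5 P \<subseteq> dilate 5 Q" using PQ by (rule cell_subset_dilate_mono) simp
  let ?h = "\<lambda>i t. norm (restr (dilate 5 Q) (f i) t)"
  have vanish: "\<Phi> y = 0" if y: "\<And>i. y $ i \<in> dilate 5 P" for y
  proof -
    have "restr (dilate 5 Q) (f i) (y $ i) = restr (dilate 5 P) (f i) (y $ i)" for i
      using y[of i] sub by (auto simp: restr_def)
    then show ?thesis by (simp add: \<Phi>_def)
  qed
  have Phi: "norm (\<Phi> y) \<le> (\<Prod>i\<in>UNIV. ?h i (y $ i))" for y
  proof (cases "\<forall>i. y $ i \<in> dilate 5 P")
    case True
    then show ?thesis using vanish[of y] by (simp add: prod_nonneg)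
  next
    case False
    then obtain j where "y $ j \<notin> dilate 5 P" by blast
    then have "restr (dilate 5 P) (f j) (y $ j) = 0" by (simp add: restr_def)
    then have p0: "(\<Prod>i\<in>UNIV. restr (dilate 5 P) (f i) (y $ i)) = 0" by (intro prod_zero) auto
    show ?thesis unfolding \<Phi>_def p0 by (simp add: prod_norm)
  qed
  have "(\<integral>\<^sup>+y. ennreal (norm (W y)) \<partial>lebesgue) \<le> hormander_const r K * ennreal ((\<Prod>i\<in>UNIV. b i) powr (1 / r))"
  proof (rule hormander_integral_le[where c = "center P" and l = "2 * side P" and h = ?h and x = x and z = z])
    show "1 \<le> r" "0 < 2 * side P" "hormander_const r K < \<infinity>" using r H by auto
    show "x \<in> cube (center P) (2 * side P / 2)" "z \<in> cube (center P) (2 * side P / 2)"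
      using xz cell_subset_dilate[of 1 P] by (auto simp: dilate_def)
    show "W \<in> borel_measurable lebesgue" using Wint by auto
    show "?h i \<in> borel_measurable borel" for i using f by measurable
    show "0 \<le> ?h i t" for i t by simp
    show "norm (W y) \<le> norm (K x y - K z y) * (\<Prod>i\<in>UNIV. ?h i (y $ i))" for y
      unfolding W_def norm_mult using Phi by (intro mult_left_mono) auto
    show "W y = 0" if "y \<in> set_pow (cube (center P) (2 * side P))" for y
    proof -
      have "cube (center P) (2 * side P) \<subseteq> dilate 5 P"
      proof -
        have "2 * side P / 2 \<le> 5 * side P / 2" by simp
        then show ?thesis unfolding dilate_def cube_def by (blast intro: order_trans)
      qed
      then have "\<Phi> y = 0" using that by (intro vanish) (auto simp: set_pow_def)
      then show ?thesis by (simp add: W_def)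
    qed
    show "0 \<le> b i" for i by (rule b0)
    fix k :: nat and i assume "1 \<le> k"
    let ?R = "ancestor (k + 1) P" and ?Q = "cube (center P) (2 ^ k * (2 * side P))"
    have s: "2 ^ k * (2 * side P) = side ?R" by (simp add: side_ancestor)
    have "?Q = dilate (2 ^ (k + 1)) P" by (simp add: dilate_def mult_ac)
    also have "\<dots> \<subseteq> dilate 5 ?R"
      by (rule dilate_subset_dilate_ancestor) (simp add: side_ancestor algebra_simps)
    finally have "(\<integral>\<^sup>+t\<in>?Q. ennreal (?h i t powr r) \<partial>lebesgue) \<le> (\<integral>\<^sup>+t\<in>dilate 5 ?R. ennreal (?h i t powr r) \<partial>lebesgue)"
      by (intro nn_integral_mono) (auto simp: indicator_def)
    also have "\<dots> \<le> ennreal (b i * side ?R ^ CARD('n))"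
      using b[of ?R i] xz(2) cell_subset_ancestor by blast
    also have "b i * side ?R ^ CARD('n) = measure lebesgue ?Q * b i"
      unfolding s by (simp add: measure_cube)
    finally show "(\<integral>\<^sup>+t\<in>?Q. ennreal (?h i t powr r) \<partial>lebesgue) \<le> ennreal (measure lebesgue ?Q * b i)" .
  qed
  also have "\<dots> = ennreal (h * (\<Prod>i\<in>UNIV. b i) powr (1 / r))" using H by (simp add: ennreal_mult)
  finally have le: "(\<integral>\<^sup>+y. ennreal (norm (W y)) \<partial>lebesgue) \<le> ennreal (h * (\<Prod>i\<in>UNIV. b i) powr (1 / r))" .
  have "(\<integral>y. K x y * \<Phi> y \<partial>lebesgue) - (\<integral>y. K z y * \<Phi> y \<partial>lebesgue) = (\<integral>y. W y \<partial>lebesgue)"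
    unfolding W_eq using ix iz by (simp add: Bochner_Integration.integral_diff)
  moreover have "ennreal (norm (\<integral>y. W y \<partial>lebesgue)) \<le> (\<integral>\<^sup>+y. ennreal (norm (W y)) \<partial>lebesgue)"
    using Wint by (rule integral_norm_bound_ennreal)
  ultimately have "ennreal (norm ((\<integral>y. K x y * \<Phi> y \<partial>lebesgue) - (\<integral>y. K z y * \<Phi> y \<partial>lebesgue)))
      \<le> ennreal (h * (\<Prod>i\<in>UNIV. b i) powr (1 / r))" using le by simp
  then show ?thesis using H by (subst (asm) ennreal_le_iff) auto
qed

lemma cell_subset_interior_dilate:
  assumes "1 < a" shows "cell q \<subseteq> interior (dilate a q)"
proof -
  let ?U = "box (\<chi> j. center q $ j - a * side q / 2) (\<chi> j. center q $ j + a * side q / 2)"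
  have "side q / 2 < a * side q / 2" using assms by simp
  have "cell q \<subseteq> ?U"
  proof
    fix x assume "x \<in> cell q"
    then have "\<bar>x $ j - center q $ j\<bar> < a * side q / 2" for j
      using mem_cell_center[of x q j] \<open>side q / 2 < a * side q / 2\<close> by linarith
    then have "center q $ j - a * side q / 2 < x $ j \<and> x $ j < center q $ j + a * side q / 2" for j
      unfolding abs_less_iff by (smt (verit))
    then show "x \<in> ?U" by (simp add: mem_box_cart)
  qed
  moreover have "?U \<subseteq> interior (dilate a q)"
    by (rule interior_maximal) (auto simp: dilate_def cube_eq_cbox box_subset_cbox open_box)
  ultimately show ?thesis by blast
qed

text \<open>
  The heart of the argument. Let \<open>G\<close> contain the set where \<open>T\<close> of the truncated functions is large and the
  set where their maximal functions are large; \<open>\<kappa>\<close> and \<open>\<Lambda>\<close> make it small compared with \<open>Q\<close>. Outside the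
  stopping cells of \<open>G\<close> the bound is immediate. In a stopping cell \<open>P\<close> compare with a point \<open>z \<in> P\<close>: the
  difference between truncation to \<open>5Q\<close> and to \<open>5P\<close> changes by at most the Hoermander constant times
  averages when \<open>x\<close> is replaced by \<open>z\<close>, and at a good \<open>z\<close> both values of \<open>T\<close> are under control.
\<close>

lemma sparse_step:
  fixes T :: "('m::finite \<Rightarrow> real ^ 'n \<Rightarrow> 'a::{real_normed_field, banach, second_countable_topology}) \<Rightarrow> real ^ 'n \<Rightarrow> 'a"
  assumes r: "1 \<le> r" and T: "singular_integral_operator r T K"
    and a: "weak_op_norm r T = ennreal a" "0 \<le> a" and h: "hormander_const r K = ennreal h" "0 \<le> h"
    and f: "\<And>i. f i \<in> Lspace r" "\<And>i. f i \<in> borel_measurable borel"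
    and k: "0 < \<kappa>" "5 ^ CARD('n) * \<kappa> powr (- (r / real CARD('m))) \<le> 1 / 2 ^ (CARD('n) + 4)"
    and L: "5 ^ CARD('n) \<le> \<Lambda>" "real CARD('m) * (245 ^ CARD('n) / \<Lambda>) \<le> 1 / 2 ^ (CARD('n) + 3)"
    and c: "c = \<Lambda> powr (real CARD('m) / r) + \<kappa> + \<kappa> * \<Lambda> powr (real CARD('m) / r)"
  shows "\<exists>C. (\<forall>P\<in>C. cell P \<subseteq> cell Q) \<and> disjoint_family_on cell C \<and>
    2 * emeasure lebesgue (\<Union>P\<in>C. cell P) \<le> emeasure lebesgue (cell Q) \<and>
    (AE x in lebesgue. x \<in> cell Q - (\<Union>P\<in>C. cell P) \<longrightarrow>
      norm (T (\<lambda>i. restr (dilate 5 Q) (f i)) x) \<le> c * (a + h) * prod_avg r f Q) \<and>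
    (\<forall>P\<in>C. AE x in lebesgue. x \<in> cell P \<longrightarrow>
      norm (T (\<lambda>i. restr (dilate 5 Q) (f i)) x)
        \<le> c * (a + h) * prod_avg r f Q + norm (T (\<lambda>i. restr (dilate 5 P) (f i)) x))"
proof -
  let ?n = "CARD('n)" and ?m = "emeasure lebesgue" and ?t = "real CARD('m) / r"
  let ?f = "\<lambda>Q i. restr (dilate 5 Q) (f i)"
  let ?D = "prod_avg r f Q"
  have D0: "0 \<le> prod_avg r f Q" for Q by (rule prod_avg_nonneg)
  have L0: "0 < \<Lambda>" using L(1) by (rule less_le_trans[rotated]) simp
  have ml: "multilinear_operator r T" using T by (simp add: singular_integral_operator_def)
  have fL: "?f Q i \<in> Lspace r" for Q i using f(1) by (rule restr_Lspace) simp
  define X where "X P = {x. norm (T (?f P) x) > \<kappa> * a * prod_avg r f P}" for P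
  have X_meas: "X P \<in> sets lebesgue" for P
  proof -
    have [measurable]: "T (?f P) \<in> borel_measurable lebesgue" using ml fL by (auto simp: multilinear_operator_def)
    have "{x \<in> space lebesgue. norm (T (?f P) x) > \<kappa> * a * prod_avg r f P} \<in> sets lebesgue" by measurable
    then show ?thesis by (simp add: X_def)
  qed
  have X_small: "?m (X P) \<le> ennreal (side P ^ ?n / 2 ^ (?n + 4))" for P
  proof -
    have "?m (X P) \<le> ennreal ((5 * side P) ^ ?n * \<kappa> powr (- (r / real CARD('m))))"
      unfolding X_def by (rule local_weak_type[OF r ml a f(1) k(1)])
    also have "(5 * side P) ^ ?n * \<kappa> powr (- (r / real CARD('m))) = side P ^ ?n * (5 ^ ?n * \<kappa> powr (- (r / real CARD('m))))"
      by (simp add: power_mult_distrib)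
    also have "ennreal \<dots> \<le> ennreal (side P ^ ?n * (1 / 2 ^ (?n + 4)))"
      by (intro ennreal_leI mult_left_mono k(2)) auto
    finally show ?thesis by simp
  qed
  \<comment> \<open>An open superset is a union of cells, as the choice of stopping cells requires.\<close>
  obtain V where V: "open V" "X Q \<subseteq> V" "V - X Q \<in> lmeasurable" "?m (V - X Q) < ennreal (side Q ^ ?n / 2 ^ (?n + 4))"
    using sets_lebesgue_outer_open[OF X_meas[of Q], of "side Q ^ ?n / 2 ^ (?n + 4)"] by auto
  define E where "E = high_avg \<Lambda> r f Q"
  define G where "G = V \<union> E"
  have V_meas: "V \<in> sets lebesgue" using V(1) by (simp add: borel_open sets_completionI_sets)
  have E_meas: "E \<in> sets lebesgue" unfolding E_def by (rule high_avg_measurable)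
  have G_meas: "G \<in> sets lebesgue" unfolding G_def using V_meas E_meas by auto
  have G_small: "?m G \<le> ennreal (side Q ^ ?n / 2 ^ (?n + 2))"
  proof -
    have "?m V = ?m (X Q \<union> (V - X Q))" using V(2) by (simp add: Un_absorb1)
    also have "\<dots> \<le> ?m (X Q) + ?m (V - X Q)" by (intro emeasure_subadditive sets.Diff X_meas V_meas)
    also have "\<dots> \<le> ennreal (side Q ^ ?n / 2 ^ (?n + 4)) + ennreal (side Q ^ ?n / 2 ^ (?n + 4))"
      using X_small[of Q] V(4) by (intro add_mono) auto
    finally have 1: "?m V \<le> ennreal (side Q ^ ?n / 2 ^ (?n + 4)) + ennreal (side Q ^ ?n / 2 ^ (?n + 4))" .
    have "?m E \<le> ennreal (real CARD('m) * ((245 * side Q) ^ ?n / \<Lambda>))"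
      unfolding E_def by (rule emeasure_high_avg[OF f(1) L0])
    also have "real CARD('m) * ((245 * side Q) ^ ?n / \<Lambda>) = side Q ^ ?n * (real CARD('m) * (245 ^ ?n / \<Lambda>))"
      by (simp add: power_mult_distrib)
    also have "ennreal \<dots> \<le> ennreal (side Q ^ ?n * (1 / 2 ^ (?n + 3)))"
      by (intro ennreal_leI mult_left_mono L(2)) auto
    finally have 2: "?m E \<le> ennreal (side Q ^ ?n / 2 ^ (?n + 3))" by simp
    have "?m G \<le> ?m V + ?m E" unfolding G_def by (rule emeasure_subadditive) (use V_meas E_meas in auto)
    also have "\<dots> \<le> (ennreal (side Q ^ ?n / 2 ^ (?n + 4)) + ennreal (side Q ^ ?n / 2 ^ (?n + 4))) + ennreal (side Q ^ ?n / 2 ^ (?n + 3))"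
      using 1 2 by (rule add_mono)
    also have "\<dots> = ennreal (side Q ^ ?n / 2 ^ (?n + 4) + side Q ^ ?n / 2 ^ (?n + 4) + side Q ^ ?n / 2 ^ (?n + 3))"
      by (simp only: ennreal_plus[symmetric] divide_nonneg_nonneg zero_le_power side_nonneg add_nonneg_nonneg zero_le_numeral)
    also have "side Q ^ ?n / 2 ^ (?n + 4) + side Q ^ ?n / 2 ^ (?n + 4) + side Q ^ ?n / 2 ^ (?n + 3) = side Q ^ ?n / 2 ^ (?n + 2)"
      by (simp add: power_add)
    finally show ?thesis .
  qed
  have G_cells: "\<exists>p. fst p \<le> fst Q \<and> x \<in> cell p \<and> cell p \<subseteq> G" if "x \<in> G" for x
  proof (cases "x \<in> V")
    case True
    then obtain k where "k \<le> fst Q" "cell (cell_at k x) \<subseteq> V" using small_cell_in_open[OF V(1)] by metis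
    then show ?thesis by (intro exI[of _ "cell_at k x"]) (auto simp: G_def)
  next
    case False
    then have "x \<in> high_avg \<Lambda> r f Q" using that by (simp add: G_def E_def)
    then obtain p where "fst p \<le> fst Q" "x \<in> cell p" "cell p \<subseteq> high_avg \<Lambda> r f Q"
      unfolding high_avg_def by blast
    then show ?thesis unfolding G_def E_def by blast
  qed
  obtain C where C: "\<And>P. P \<in> C \<Longrightarrow> cell P \<subseteq> cell Q" "disjoint_family_on cell C"
    "2 * ?m (\<Union>P\<in>C. cell P) \<le> ?m (cell Q)" "cell Q \<inter> G \<subseteq> (\<Union>P\<in>C. cell P)"
    "\<And>P. P \<in> C \<Longrightarrow> ?m (cell P \<inter> G) \<le> ennreal (side P ^ ?n / 2)"
    using stopping_cells[OF G_meas G_small G_cells] by blast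
  have out: "norm (T (?f Q) x) \<le> c * (a + h) * ?D" if "x \<notin> G" for x
  proof -
    have "x \<notin> X Q" using that V(2) by (auto simp: G_def)
    then have "norm (T (?f Q) x) \<le> \<kappa> * a * ?D" by (simp add: X_def not_less)
    also have "\<dots> \<le> c * (a + h) * ?D"
      using a h k L0 D0[of Q] by (intro mult_right_mono mult_mono) (auto simp: c)
    finally show ?thesis .
  qed
  have ins: "AE x in lebesgue. x \<in> cell P \<longrightarrow> norm (T (?f Q) x) \<le> c * (a + h) * ?D + norm (T (?f P) x)"
    if P: "P \<in> C" for P
  proof -
    have PQ: "cell P \<subseteq> cell Q" using C(1) P .
    have sub: "dilate 5 P \<subseteq> dilate 5 Q" using PQ by (rule cell_subset_dilate_mono) simp
    define \<Phi> where "\<Phi> y = (\<Prod>i\<in>UNIV. ?f Q i (y $ i)) - (\<Prod>i\<in>UNIV. ?f P i (y $ i))" for y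
    have rep: "AE x in lebesgue. x \<in> interior (dilate 5 P) \<longrightarrow>
      integrable lebesgue (\<lambda>y. K x y * \<Phi> y) \<and> T (?f Q) x - T (?f P) x = (\<integral>y. K x y * \<Phi> y \<partial>lebesgue)"
      unfolding \<Phi>_def by (rule kernel_difference[OF T f(1) _ _ _ sub]) (auto intro: compact_imp_bounded)
    have rep': "AE x in lebesgue. x \<in> cell P \<longrightarrow>
      integrable lebesgue (\<lambda>y. K x y * \<Phi> y) \<and> T (?f Q) x - T (?f P) x = (\<integral>y. K x y * \<Phi> y \<partial>lebesgue)"
      using rep by eventually_elim (use cell_subset_interior_dilate[of 5 P] in auto)
    \<comment> \<open>\<open>G\<close> fills at most half of \<open>P\<close> and \<open>X P\<close> at most a sixteenth, so a positive fraction of \<open>P\<close> is left.\<close>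
    obtain z where z: "z \<in> cell P" "z \<notin> G" "z \<notin> X P" "integrable lebesgue (\<lambda>y. K z y * \<Phi> y)"
      "T (?f Q) z - T (?f P) z = (\<integral>y. K z y * \<Phi> y \<partial>lebesgue)"
    proof (rule ccontr)
      assume "\<not> thesis"
      then have none: "\<not> (z \<in> cell P \<and> z \<notin> G \<and> z \<notin> X P \<and> integrable lebesgue (\<lambda>y. K z y * \<Phi> y) \<and>
        T (?f Q) z - T (?f P) z = (\<integral>y. K z y * \<Phi> y \<partial>lebesgue))" for z using that by blast
      have "AE x in lebesgue. x \<in> cell P \<longrightarrow> x \<in> (cell P \<inter> G) \<union> X P"
        using rep' by eventually_elim (use none in blast)
      then have "?m (cell P) \<le> ?m ((cell P \<inter> G) \<union> X P)"
        by (intro emeasure_mono_AE sets.Un sets.Int lebesgue_cell G_meas X_meas)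
      also have "\<dots> \<le> ?m (cell P \<inter> G) + ?m (X P)"
        by (intro emeasure_subadditive sets.Int lebesgue_cell G_meas X_meas)
      also have "\<dots> \<le> ennreal (side P ^ ?n / 2) + ennreal (side P ^ ?n / 2 ^ (?n + 4))"
        using C(5)[OF P] X_small by (rule add_mono)
      also have "\<dots> = ennreal (side P ^ ?n / 2 + side P ^ ?n / 2 ^ (?n + 4))" by (simp add: ennreal_plus)
      finally have "side P ^ ?n \<le> side P ^ ?n / 2 + side P ^ ?n / 2 ^ (?n + 4)"
        unfolding emeasure_cell by (subst (asm) ennreal_le_iff) auto
      moreover have "side P ^ ?n / 2 ^ (?n + 4) < side P ^ ?n / 2"
      proof (rule divide_strict_left_mono)
        show "(2::real) < 2 ^ (?n + 4)" using power_strict_increasing[of 1 "?n + 4" "2::real"] by simp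
      qed auto
      ultimately show False by linarith
    qed
    define b where "b i = \<Lambda> * avg r (f i) Q" for i
    have b0: "0 \<le> b i" for i using L0 by (simp add: b_def avg_nonneg)
    have good: "(\<integral>\<^sup>+t\<in>dilate 5 R. ennreal (norm (restr (dilate 5 Q) (f i) t) powr r) \<partial>lebesgue)
        \<le> ennreal (b i * side R ^ ?n)" if "z \<in> cell R" for R i
      unfolding b_def by (rule averages_outside_high_avg[OF f(1) L(1) _ that]) (use z in \<open>auto simp: G_def E_def\<close>)
    have bprod: "(\<Prod>i\<in>UNIV. b i) powr (1 / r) = \<Lambda> powr ?t * ?D"
    proof -
      have "(\<Prod>i\<in>UNIV. b i) = \<Lambda> ^ CARD('m) * (\<Prod>i\<in>UNIV. avg r (f i) Q)" by (simp add: b_def prod.distrib)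
      moreover have "(\<Prod>i\<in>UNIV. avg r (f i) Q) powr (1 / r) = ?D"
        unfolding prod_avg_def by (rule prod_powr_distrib)
      moreover have "(\<Lambda> ^ CARD('m)) powr (1 / r) = \<Lambda> powr ?t" using L0 by (simp add: powr_realpow[symmetric] powr_powr)
      ultimately show ?thesis by (simp add: powr_mult)
    qed
    have DP: "prod_avg r f P \<le> \<Lambda> powr ?t * ?D"
    proof -
      have "avg r (f i) P \<le> b i" for i
      proof -
        have "ennreal (avg r (f i) P * (5 * side P) ^ ?n) = (\<integral>\<^sup>+t. ennreal (norm (restr (dilate 5 P) (f i) t) powr r) \<partial>lebesgue)"
          by (rule integral_restr_dilate(2)[OF f(1), symmetric])
        also have "\<dots> = (\<integral>\<^sup>+t\<in>dilate 5 P. ennreal (norm (restr (dilate 5 Q) (f i) t) powr r) \<partial>lebesgue)"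
          by (intro nn_integral_cong) (use sub in \<open>auto simp: restr_def indicator_def\<close>)
        also have "\<dots> \<le> ennreal (b i * side P ^ ?n)" by (rule good[OF z(1)])
        finally have "avg r (f i) P * (5 * side P) ^ ?n \<le> b i * side P ^ ?n"
          using b0 by (subst (asm) ennreal_le_iff) auto
        then have "(avg r (f i) P * 5 ^ ?n) * side P ^ ?n \<le> b i * side P ^ ?n" by (simp add: power_mult_distrib mult_ac)
        then have "avg r (f i) P * 5 ^ ?n \<le> b i" by (simp only: mult_le_cancel_right_pos zero_less_power side_pos)
        moreover have "avg r (f i) P * 1 \<le> avg r (f i) P * 5 ^ ?n" by (intro mult_left_mono avg_nonneg) simp
        ultimately show ?thesis by simp
      qed
      then have "prod_avg r f P \<le> (\<Prod>i\<in>UNIV. b i powr (1 / r))"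
        unfolding prod_avg_def using r by (intro prod_mono) (auto intro!: powr_mono2 avg_nonneg)
      also have "\<dots> = (\<Prod>i\<in>UNIV. b i) powr (1 / r)" by (rule prod_powr_distrib[symmetric])
      finally show ?thesis by (simp add: bprod)
    qed
    have zbound: "norm (T (?f Q) z - T (?f P) z) \<le> \<kappa> * a * ?D + \<kappa> * a * (\<Lambda> powr ?t * ?D)"
    proof -
      have "z \<notin> X Q" using z(2) V(2) by (auto simp: G_def)
      then have "norm (T (?f Q) z) \<le> \<kappa> * a * ?D" by (simp add: X_def not_less)
      moreover have "norm (T (?f P) z) \<le> \<kappa> * a * prod_avg r f P" using z(3) by (simp add: X_def not_less)
      moreover have "\<kappa> * a * prod_avg r f P \<le> \<kappa> * a * (\<Lambda> powr ?t * ?D)" using DP k a by (intro mult_left_mono) auto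
      ultimately show ?thesis using norm_triangle_ineq4[of "T (?f Q) z" "T (?f P) z"] by linarith
    qed
    show ?thesis using rep'
    proof eventually_elim
      case (elim x)
      show ?case
      proof
        assume x: "x \<in> cell P"
        then have ix: "integrable lebesgue (\<lambda>y. K x y * \<Phi> y)"
          and Tx: "T (?f Q) x - T (?f P) x = (\<integral>y. K x y * \<Phi> y \<partial>lebesgue)" using elim by auto
        have osc: "norm ((\<integral>y. K x y * \<Phi> y \<partial>lebesgue) - (\<integral>y. K z y * \<Phi> y \<partial>lebesgue)) \<le> h * (\<Prod>i\<in>UNIV. b i) powr (1 / r)"
          unfolding \<Phi>_def
          by (rule kernel_oscillation[where f = f and b = b, OF r h f(2) PQ x z(1) b0])
            (erule good | rule ix[unfolded \<Phi>_def] | rule z(4)[unfolded \<Phi>_def])+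
        let ?osc = "(\<integral>y. K x y * \<Phi> y \<partial>lebesgue) - (\<integral>y. K z y * \<Phi> y \<partial>lebesgue)"
        have eq: "T (?f Q) x = T (?f P) x + ?osc + (T (?f Q) z - T (?f P) z)"
          unfolding Tx[symmetric] z(5)[symmetric] by simp
        have "norm (T (?f Q) x) \<le> norm (T (?f P) x) + norm ?osc + norm (T (?f Q) z - T (?f P) z)"
          by (subst eq) (intro order_trans[OF norm_triangle_ineq] add_right_mono norm_triangle_ineq)
        also have "\<dots> \<le> norm (T (?f P) x) + h * (\<Lambda> powr ?t * ?D) + (\<kappa> * a * ?D + \<kappa> * a * (\<Lambda> powr ?t * ?D))"
          using osc zbound unfolding bprod by (intro add_mono order_refl)
        also have "\<dots> \<le> norm (T (?f P) x) + c * (a + h) * ?D"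
        proof -
          have "0 \<le> a * \<Lambda> powr ?t * ?D + (\<kappa> + \<kappa> * \<Lambda> powr ?t) * h * ?D"
            using a h k D0[of Q] by (intro add_nonneg_nonneg mult_nonneg_nonneg) auto
          then show ?thesis by (simp add: c algebra_simps)
        qed
        finally show "norm (T (?f Q) x) \<le> c * (a + h) * ?D + norm (T (?f P) x)" by simp
      qed
    qed
  qed
  have "AE x in lebesgue. x \<in> cell Q - (\<Union>P\<in>C. cell P) \<longrightarrow> norm (T (?f Q) x) \<le> c * (a + h) * ?D"
    using out C(4) by (intro AE_I2) blast
  then show ?thesis using C(1-3) ins by (intro exI[of _ C] conjI ballI)
qed

section \<open>Borel representatives, root cells and the sparse family\<close>

text \<open>
  Redefining \<open>f\<close> as \<open>0\<close> on one null set repairs the preimages of all members of a countable basis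
  at the same time. Unlike Lebesgue measurable functions, Borel functions remain measurable when they
  are composed with the projections \<open>y \<mapsto> y\<^sub>i\<close>, as in the tensor products integrated against the kernel.
\<close>

lemma lebesgue_measurable_ex_borel:
  fixes f :: "real ^ 'n \<Rightarrow> 'a::{real_normed_field, banach, second_countable_topology}"
  assumes f: "f \<in> borel_measurable lebesgue"
  obtains g where "g \<in> borel_measurable borel" "AE x in lebesgue. f x = g x"
proof -
  obtain \<B> :: "'a set set" where \<B>: "countable \<B>" "topological_basis \<B>"
    using ex_countable_basis by blast
  have pre: "f -` S \<in> sets lebesgue" if "S \<in> \<B>" for S
    using measurable_sets[OF f, of S] topological_basis_open[OF \<B>(2) that] by (simp add: borel_open)
  have "\<exists>N. N \<in> null_sets lborel \<and> null_part lborel (f -` S) \<subseteq> N" if "S \<in> \<B>" for S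
    using null_part pre[OF that] by blast
  then obtain N where N: "\<And>S. S \<in> \<B> \<Longrightarrow> N S \<in> null_sets lborel"
    "\<And>S. S \<in> \<B> \<Longrightarrow> null_part lborel (f -` S) \<subseteq> N S" by metis
  define Z where "Z = (\<Union>S\<in>\<B>. N S)"
  have Z: "Z \<in> null_sets lborel" unfolding Z_def using \<B>(1) N(1) by (rule null_sets_UN')
  then have Zb: "Z \<in> sets borel" by auto
  define g where "g x = (if x \<in> Z then 0 else f x)" for x
  have "g \<in> borel_measurable borel"
  proof (rule borel_measurableI)
    fix U :: "'a set" assume "open U"
    then obtain V where V: "V \<subseteq> \<B>" "\<Union>V = U" using \<B>(2) by (auto simp: topological_basis_def)
    have part: "f -` S - Z = main_part lborel (f -` S) - Z" if "S \<in> V" for S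
      using main_part_null_part_Un[OF pre[of S]] N(2)[of S] that V(1) by (force simp: Z_def)
    have "g -` U = (\<Union>S\<in>V. f -` S - Z) \<union> (if 0 \<in> U then Z else {})"
      using V(2) by (auto simp: g_def split: if_splits)
    also have "(\<Union>S\<in>V. f -` S - Z) = (\<Union>S\<in>V. main_part lborel (f -` S) - Z)" using part by simp
    also have "\<dots> \<union> (if 0 \<in> U then Z else {}) \<in> sets borel"
    proof (intro sets.Un sets.countable_UN'')
      show "countable V" using V(1) \<B>(1) by (rule countable_subset)
      show "main_part lborel (f -` S) - Z \<in> sets borel" if "S \<in> V" for S
        using main_part_sets[OF pre[of S]] that V(1) Zb by auto
    qed (use Zb in auto)
    finally show "g -` U \<inter> space borel \<in> sets borel" by simp
  qed
  moreover have "AE x in lebesgue. f x = g x"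
  proof -
    have "AE x in lborel. x \<notin> Z" by (rule AE_not_in[OF Z])
    then have "AE x in lebesgue. x \<notin> Z" by (rule AE_completion)
    then show ?thesis by eventually_elim (simp add: g_def)
  qed
  ultimately show ?thesis by (rule that)
qed

lemma inj_dilate: "0 < a \<Longrightarrow> inj (dilate a)"
proof (rule injI)
  fix p q :: "int \<times> (int ^ 'n)" assume a: "0 < a" and eq: "dilate a p = dilate a q"
  have "center p \<in> dilate a p" using a by (simp add: mem_dilate)
  with eq have e: "center p $ j - a * side p / 2 = center q $ j - a * side q / 2"
      "center p $ j + a * side p / 2 = center q $ j + a * side q / 2" for j
    unfolding dilate_def cube_eq_cbox eq_cbox by (auto simp: vec_eq_iff)
  have c: "center p $ j = center q $ j" for j using e[of j] by linarith
  have "a * side p = a * side q" using e[of undefined] by linarith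
  then have s': "side p = side q" using a by simp
  have "\<not> fst p < fst q" "\<not> fst q < fst p"
    using s' power_int_strict_increasing[of "fst p" "fst q" "2 :: real"]
      power_int_strict_increasing[of "fst q" "fst p" "2 :: real"] by (auto simp: side_def)
  then have 1: "fst p = fst q" by linarith
  have "real_of_int (snd p $ j) = real_of_int (snd q $ j)" for j
    using c[of j] s' by (simp add: center_def)
  then have "snd p = snd q" by (simp add: vec_eq_iff)
  with 1 show "p = q" by (rule prod_eqI)
qed

text \<open>
  A partition of the whole space into cells whose fivefold dilates all contain a given cube. The roots
  are the maximal cells whose doubles do not contain the cube; then the double of the parent does, and it
  lies in the fivefold dilate of the root. The lower bound on \<open>l\<close> ensures that every point lies in
  some small cell whose double does not contain the cube.
\<close>

lemma root_cells:
  assumes l: "1 \<le> l"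
  obtains R :: "(int \<times> (int ^ 'n)) set" where "disjoint_family_on cell R" "(\<Union>q\<in>R. cell q) = UNIV"
    "\<And>q. q \<in> R \<Longrightarrow> cube 0 l \<subseteq> dilate 5 q"
proof -
  define B where "B = {q :: int \<times> (int ^ 'n). \<not> cube 0 l \<subseteq> dilate 2 q}"
  show ?thesis
  proof (rule that[of "maximal_cells B"])
    show "disjoint_family_on cell (maximal_cells B)" by (rule maximal_cells_disjoint)
    show "(\<Union>q\<in>maximal_cells B. cell q) = UNIV"
    proof (intro set_eqI iffI UNIV_I)
      fix x :: "real ^ 'n"
      \<comment> \<open>The double of a cell of side \<open>1/4\<close> has side \<open>1/2 < l\<close> and cannot contain the cube.\<close>
      define p where "p = cell_at (- 2) x"
      have sp: "side p = 1 / 4" by (simp add: p_def side_def)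
      have "p \<in> B"
      proof (rule ccontr)
        assume "p \<notin> B"
        then have "cube 0 l \<subseteq> dilate 2 p" by (simp add: B_def)
        then have "emeasure lebesgue (cube 0 l :: (real ^ 'n) set) \<le> emeasure lebesgue (dilate 2 p)"
          by (rule emeasure_mono) simp
        then have "l ^ CARD('n) \<le> (1 / 2) ^ CARD('n)"
          using l by (simp add: emeasure_cube emeasure_dilate sp ennreal_le_iff)
        moreover have "(1 / 2) ^ CARD('n) < l ^ CARD('n)" using l by (intro power_strict_mono) auto
        ultimately show False by simp
      qed
      define \<delta> where "\<delta> = l / 2 + (\<Sum>j\<in>UNIV. \<bar>x $ j\<bar>)"
      obtain N where N: "\<delta> / (side p / 2) < 2 ^ N" using real_arch_pow[of 2 "\<delta> / (side p / 2)"] by auto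
      have "i \<le> N" if "ancestor i p \<in> B" for i
      proof (rule ccontr)
        assume "\<not> i \<le> N"
        then have "(2 :: real) ^ N \<le> 2 ^ i" by (intro power_increasing) auto
        then have "2 ^ N * (side p / 2) \<le> 2 ^ i * (side p / 2)" by (intro mult_right_mono) auto
        moreover have "\<delta> < 2 ^ N * (side p / 2)" using N by (simp only: pos_divide_less_eq half_gt_zero side_pos)
        ultimately have "\<delta> \<le> 2 ^ i * (side p / 2)" by linarith
        then have d: "\<delta> \<le> side (ancestor i p) / 2" by (simp add: side_ancestor)
        have xi: "x \<in> cell (ancestor i p)" using cell_subset_ancestor[of p i] by (auto simp: p_def)
        have "cube 0 l \<subseteq> dilate 2 (ancestor i p)"
        proof
          fix y :: "real ^ 'n" assume y: "y \<in> cube 0 l"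
          show "y \<in> dilate 2 (ancestor i p)" unfolding mem_dilate
          proof
            fix j
            have "\<bar>y $ j\<bar> \<le> l / 2" using y by (simp add: cube_def)
            moreover have "\<bar>x $ j\<bar> \<le> (\<Sum>j\<in>UNIV. \<bar>x $ j\<bar>)" by (rule member_le_sum) auto
            moreover note mem_cell_center[OF xi, of j]
            ultimately show "\<bar>y $ j - center (ancestor i p) $ j\<bar> \<le> 2 * side (ancestor i p) / 2"
              using d unfolding \<delta>_def by linarith
          qed
        qed
        then show False using that by (simp add: B_def)
      qed
      then obtain i where "ancestor i p \<in> maximal_cells B" using maximal_ancestor[of p B N] \<open>p \<in> B\<close> by blast
      moreover have "x \<in> cell (ancestor i p)" using cell_subset_ancestor[of p i] by (auto simp: p_def)
      ultimately show "x \<in> (\<Union>q\<in>maximal_cells B. cell q)" by blast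
    qed
    fix q assume "q \<in> maximal_cells B"
    then have "cube 0 l \<subseteq> dilate 2 (ancestor 1 q)" by (simp add: maximal_cells_def B_def)
    also have "\<dots> \<subseteq> dilate 5 q"
    proof
      fix y assume y: "y \<in> dilate 2 (ancestor 1 q)"
      show "y \<in> dilate 5 q" unfolding mem_dilate
      proof
        fix j
        have "\<bar>y $ j - center (ancestor 1 q) $ j\<bar> \<le> 2 * side q" using y by (simp add: mem_dilate side_ancestor)
        moreover have "\<bar>center q $ j - center (ancestor 1 q) $ j\<bar> \<le> side q / 2"
          using center_ancestor[of q j 1] by (simp add: side_ancestor)
        ultimately show "\<bar>y $ j - center q $ j\<bar> \<le> 5 * side q / 2" by linarith
      qed
    qed
    finally show "cube 0 l \<subseteq> dilate 5 q" .
  qed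
qed

text \<open>
  Multiplication by \<open>c\<close> is not continuous on \<open>[0, \<infinity>]\<close>, so the estimate goes through the finite partial sums.
\<close>

lemma infsum_ennreal_cmult_le:
  fixes f :: "'b \<Rightarrow> ennreal"
  shows "(\<Sum>\<^sub>\<infinity>x\<in>A. c * f x) \<le> c * (\<Sum>\<^sub>\<infinity>x\<in>A. f x)"
proof (rule infsum_le_finite_sums)
  show "(\<lambda>x. c * f x) summable_on A" by (auto intro: nonneg_summable_on_complete)
  fix F assume F: "finite F" "F \<subseteq> A"
  have "(\<Sum>x\<in>F. c * f x) = c * infsum f F" using F by (simp add: sum_distrib_left)
  also have "\<dots> \<le> c * infsum f A" by (intro mult_left_mono infsum_ennreal_mono_set F) auto
  finally show "(\<Sum>x\<in>F. c * f x) \<le> c * (\<Sum>\<^sub>\<infinity>x\<in>A. f x)" .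
qed

lemma prod_avg_cong_AE:
  assumes "\<And>i. f i \<in> borel_measurable lebesgue" "\<And>i. g i \<in> borel_measurable lebesgue" "\<And>i. AE x in lebesgue. f i x = g i x"
  shows "prod_avg r f Q = prod_avg r g Q"
proof -
  have "avg r (f i) Q = avg r (g i) Q" for i
  proof -
    note [measurable] = assms(1)[of i] assms(2)[of i]
    have "(LINT y:dilate 5 Q|lebesgue. norm (f i y) powr r) = (LINT y:dilate 5 Q|lebesgue. norm (g i y) powr r)"
    proof (rule set_lebesgue_integral_cong_AE)
      show "AE x\<in>dilate 5 Q in lebesgue. norm (f i x) powr r = norm (g i x) powr r"
        using assms(3)[of i] by eventually_elim simp
    qed (simp, measurable)
    then show ?thesis by (simp add: avg_def)
  qed
  then show ?thesis by (simp add: prod_avg_def)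
qed

lemma sparse_form_dilate:
  "sparse_form r (dilate 5 ` F) f x = (\<Sum>\<^sub>\<infinity>Q\<in>F. ennreal (prod_avg r f Q * indicator (dilate 5 Q) x))"
proof -
  have "inj_on (dilate 5) F" using inj_dilate[of 5] by (rule inj_on_subset) simp_all
  then show ?thesis
    unfolding sparse_form_def by (subst infsum_reindex) (auto simp: o_def prod_avg_def avg_def)
qed

text \<open>
  Dilating the cells by \<open>5\<close> only changes the sparseness constant, from \<open>1/2\<close> to \<open>1/(2 \<cdot> 5\<^sup>n)\<close>.
\<close>

lemma sparse_family_dilate:
  fixes E :: "int \<times> (int ^ 'n) \<Rightarrow> (real ^ 'n) set"
  assumes disj: "disjoint_family_on E F"
    and E: "\<And>Q. Q \<in> F \<Longrightarrow> E Q \<in> sets lebesgue \<and> E Q \<subseteq> cell Q \<and> emeasure lebesgue (cell Q) \<le> 2 * emeasure lebesgue (E Q)"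
  shows "sparse_family (dilate 5 ` F)"
proof -
  have inj: "inj_on (dilate 5) F" using inj_dilate[of 5] by (rule inj_on_subset) simp_all
  define E' where "E' D = E (the_inv_into F (dilate 5) D)" for D
  have E': "E' (dilate 5 Q) = E Q" if "Q \<in> F" for Q
    using the_inv_into_f_f[OF inj that] by (simp add: E'_def)
  let ?\<gamma> = "1 / (2 * 5 ^ CARD('n)) :: real"
  have "measure lebesgue (E Q) \<ge> ?\<gamma> * measure lebesgue (dilate 5 Q)" if Q: "Q \<in> F" for Q
  proof -
    have "emeasure lebesgue (E Q) \<le> emeasure lebesgue (cell Q)" using E[OF Q] by (intro emeasure_mono) auto
    also have "\<dots> < \<infinity>" by (simp add: emeasure_cell)
    finally have "emeasure lebesgue (E Q) \<noteq> \<infinity>" by simp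
    then have "emeasure lebesgue (E Q) = ennreal (measure lebesgue (E Q))" by (simp add: emeasure_eq_ennreal_measure)
    then have "ennreal (side Q ^ CARD('n)) \<le> ennreal (2 * measure lebesgue (E Q))"
      using E[OF Q] by (simp add: emeasure_cell ennreal_mult)
    then have "side Q ^ CARD('n) \<le> 2 * measure lebesgue (E Q)" by (subst (asm) ennreal_le_iff) auto
    then show ?thesis by (simp add: measure_dilate power_mult_distrib)
  qed
  moreover have "is_cube (dilate 5 Q)" for Q :: "int \<times> (int ^ 'n)"
    unfolding is_cube_def dilate_def by (intro exI[of _ "center Q"] exI[of _ "5 * side Q"]) simp
  moreover have "disjoint_family_on E' (dilate 5 ` F)"
    using disj E' unfolding disjoint_family_on_def by (metis (no_types, lifting) imageE)
  moreover have "E' (dilate 5 Q) \<in> sets lebesgue \<and> E' (dilate 5 Q) \<subseteq> dilate 5 Q" if "Q \<in> F" for Q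
    using E'[OF that] E[OF that] cell_subset_dilate[of 5 Q] by auto
  moreover have "?\<gamma> < 1"
  proof -
    have "1 \<le> (5 :: real) ^ CARD('n)" by (rule one_le_power) simp
    then have "1 < 2 * (5 :: real) ^ CARD('n)" by linarith
    then show ?thesis by (simp add: divide_less_eq)
  qed
  ultimately show ?thesis
    unfolding sparse_family_def by (intro conjI exI[of _ ?\<gamma>] exI[of _ E']) (auto simp: E')
qed

theorem theorem1p2:
  fixes r :: real
  assumes "1 \<le> r"
  shows "\<exists>c::real. c > 0 \<and>
    (\<forall>(T :: ('m::finite \<Rightarrow> real ^ 'n \<Rightarrow> 'a::{real_normed_field, banach, second_countable_topology})
          \<Rightarrow> real ^ 'n \<Rightarrow> 'a)
       (K :: real ^ 'n \<Rightarrow> real ^ 'n ^ 'm \<Rightarrow> 'a).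
      singular_integral_operator r T K \<longrightarrow>
      weak_op_norm r T < \<infinity> \<longrightarrow>
      hormander_const r K < \<infinity> \<longrightarrow>
      (\<forall>f. (\<forall>i. f i \<in> Lspace r \<and> compact (ess_supp (f i))) \<longrightarrow>
        (\<exists>S. sparse_family S \<and>
          (AE x in lebesgue. ennreal (norm (T f x)) \<le>
            ennreal c * (weak_op_norm r T + hormander_const r K) * sparse_form r S f x))))"
proof -
  let ?n = "CARD('n)" and ?m = "real CARD('m)"
  \<comment> \<open>Both constants are chosen to give equality in the smallness conditions of the one-step estimate.\<close>
  define \<Lambda> where "\<Lambda> = ?m * 245 ^ ?n * 2 ^ (?n + 3)"
  define \<kappa> where "\<kappa> = (5 ^ ?n * 2 ^ (?n + 4)) powr (?m / r)"
  define c where "c = \<Lambda> powr (?m / r) + \<kappa> + \<kappa> * \<Lambda> powr (?m / r)"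
  have k0: "0 < \<kappa>" by (simp add: \<kappa>_def)
  have c0: "0 < c" unfolding c_def using k0 by (intro add_nonneg_pos add_pos_nonneg) auto
  have k1: "5 ^ ?n * \<kappa> powr (- (r / ?m)) \<le> 1 / 2 ^ (?n + 4)"
  proof -
    have "\<kappa> powr (- (r / ?m)) = (5 ^ ?n * 2 ^ (?n + 4)) powr (- 1)"
      using assms by (simp add: \<kappa>_def powr_powr)
    then show ?thesis by (simp add: powr_minus field_simps)
  qed
  have L1: "5 ^ ?n \<le> \<Lambda>"
  proof -
    have "(5 :: real) ^ ?n \<le> 1 * 245 ^ ?n * 1" by (simp add: power_mono)
    also have "\<dots> \<le> ?m * 245 ^ ?n * 2 ^ (?n + 3)"
      by (intro mult_mono) (auto simp: Suc_le_eq)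
    finally show ?thesis by (simp add: \<Lambda>_def)
  qed
  have L2: "?m * (245 ^ ?n / \<Lambda>) \<le> 1 / 2 ^ (?n + 3)" by (simp add: \<Lambda>_def)
  show ?thesis
  proof (intro exI[of _ c] conjI c0 allI impI)
    fix T :: "('m \<Rightarrow> real ^ 'n \<Rightarrow> 'a) \<Rightarrow> real ^ 'n \<Rightarrow> 'a" and K :: "real ^ 'n \<Rightarrow> real ^ 'n ^ 'm \<Rightarrow> 'a"
      and f :: "'m \<Rightarrow> real ^ 'n \<Rightarrow> 'a"
    assume T: "singular_integral_operator r T K" and A: "weak_op_norm r T < \<infinity>" and H: "hormander_const r K < \<infinity>"
      and f: "\<forall>i. f i \<in> Lspace r \<and> compact (ess_supp (f i))"
    \<comment> \<open>Both constants are finite, so the estimates can be carried out in the reals.\<close>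
    obtain a where a: "weak_op_norm r T = ennreal a" "0 \<le> a" using A by (cases "weak_op_norm r T") auto
    obtain h where h: "hormander_const r K = ennreal h" "0 \<le> h" using H by (cases "hormander_const r K") auto
    have ml: "multilinear_operator r T" using T by (simp add: singular_integral_operator_def)
    have fm: "f i \<in> borel_measurable lebesgue" for i using f by (auto simp: Lspace_def)
    have "\<exists>g. g \<in> borel_measurable borel \<and> (AE x in lebesgue. f i x = g x)" for i
      using lebesgue_measurable_ex_borel[OF fm[of i]] by metis
    then obtain g where g: "\<And>i. g i \<in> borel_measurable borel" "\<And>i. AE x in lebesgue. f i x = g i x" by metis
    have gm: "g i \<in> borel_measurable lebesgue" for i using g(1) by (rule borel_imp_lebesgue_measurable)
    have gL: "g i \<in> Lspace r" for i
    proof -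
      note [measurable] = fm[of i] gm[of i]
      have "integrable lebesgue (\<lambda>x. norm (g i x) powr r)"
      proof (rule integrable_cong_AE_imp)
        show "integrable lebesgue (\<lambda>x. norm (f i x) powr r)" using f by (simp add: Lspace_def)
        show "AE x in lebesgue. norm (f i x) powr r = norm (g i x) powr r" using g(2)[of i] by eventually_elim simp
      qed measurable
      then show ?thesis using gm by (simp add: Lspace_def)
    qed
    have "bounded (\<Union>i. ess_supp (f i))" using f compact_imp_bounded by (intro bounded_UN) (simp_all only: finite, blast)
    then obtain B where B: "\<And>x i. x \<in> ess_supp (f i) \<Longrightarrow> norm x \<le> B" unfolding bounded_iff by blast
    define l where "l = max 1 (2 * B)"
    have supp: "ess_supp (f i) \<subseteq> cube 0 l" for i
    proof
      fix x assume "x \<in> ess_supp (f i)"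
      then have "\<bar>x $ j\<bar> \<le> B" for j using B component_le_norm_cart order_trans by blast
      moreover have "B \<le> l / 2" by (simp add: l_def)
      ultimately have "\<bar>x $ j\<bar> \<le> l / 2" for j by (rule order_trans)
      then show "x \<in> cube 0 l" by (simp add: cube_def)
    qed
    obtain R :: "(int \<times> (int ^ 'n)) set" where R: "disjoint_family_on cell R" "(\<Union>q\<in>R. cell q) = UNIV"
      "\<And>q. q \<in> R \<Longrightarrow> cube 0 l \<subseteq> dilate 5 q" using root_cells[of l] by (auto simp: l_def)
    let ?g = "\<lambda>Q i. restr (dilate 5 Q) (g i)"
    define N where "N Q x = ennreal (norm (T (?g Q) x))" for Q x
    define b where "b Q = ennreal (c * (a + h) * prod_avg r g Q)" for Q :: "int \<times> (int ^ 'n)"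
    have D0: "0 \<le> c * (a + h) * prod_avg r g Q" for Q :: "int \<times> (int ^ 'n)"
      using c0 a h by (intro mult_nonneg_nonneg prod_avg_nonneg add_nonneg_nonneg) auto
    have "\<exists>C. (\<forall>P\<in>C. cell P \<subseteq> cell Q) \<and> disjoint_family_on cell C \<and>
      2 * emeasure lebesgue (\<Union>P\<in>C. cell P) \<le> emeasure lebesgue (cell Q) \<and>
      (AE x in lebesgue. x \<in> cell Q - (\<Union>P\<in>C. cell P) \<longrightarrow> N Q x \<le> b Q) \<and>
      (\<forall>P\<in>C. AE x in lebesgue. x \<in> cell P \<longrightarrow> N Q x \<le> b Q + N P x)" for Q
    proof -
      obtain C where C: "\<forall>P\<in>C. cell P \<subseteq> cell Q" "disjoint_family_on cell C"
        "2 * emeasure lebesgue (\<Union>P\<in>C. cell P) \<le> emeasure lebesgue (cell Q)"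
        "AE x in lebesgue. x \<in> cell Q - (\<Union>P\<in>C. cell P) \<longrightarrow>
          norm (T (?g Q) x) \<le> c * (a + h) * prod_avg r g Q"
        "\<forall>P\<in>C. AE x in lebesgue. x \<in> cell P \<longrightarrow>
          norm (T (?g Q) x) \<le> c * (a + h) * prod_avg r g Q + norm (T (?g P) x)"
        using sparse_step[where f = g and Q = Q, OF assms T a h gL g(1) k0 k1 L1 L2 c_def] by blast
      have "AE x in lebesgue. x \<in> cell Q - (\<Union>P\<in>C. cell P) \<longrightarrow> N Q x \<le> b Q"
        using C(4) by eventually_elim (auto simp: N_def b_def intro: ennreal_leI)
      moreover have "AE x in lebesgue. x \<in> cell P \<longrightarrow> N Q x \<le> b Q + N P x" if "P \<in> C" for P
        using C(5)[rule_format, OF that] by eventually_elim (auto simp: N_def b_def D0 ennreal_plus[symmetric] simp del: ennreal_plus intro: ennreal_leI)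
      ultimately show ?thesis using C(1-3) by (intro exI[of _ C] conjI ballI) auto
    qed
    then obtain ch where ch: "\<forall>Q. (\<forall>P\<in>ch Q. cell P \<subseteq> cell Q) \<and> disjoint_family_on cell (ch Q) \<and>
      2 * emeasure lebesgue (\<Union>P\<in>ch Q. cell P) \<le> emeasure lebesgue (cell Q) \<and>
      (AE x in lebesgue. x \<in> cell Q - (\<Union>P\<in>ch Q. cell P) \<longrightarrow> N Q x \<le> b Q) \<and>
      (\<forall>P\<in>ch Q. AE x in lebesgue. x \<in> cell P \<longrightarrow> N Q x \<le> b Q + N P x)"
      using choice[of "\<lambda>Q C. (\<forall>P\<in>C. cell P \<subseteq> cell Q) \<and> disjoint_family_on cell C \<and>
        2 * emeasure lebesgue (\<Union>P\<in>C. cell P) \<le> emeasure lebesgue (cell Q) \<and>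
        (AE x in lebesgue. x \<in> cell Q - (\<Union>P\<in>C. cell P) \<longrightarrow> N Q x \<le> b Q) \<and>
        (\<forall>P\<in>C. AE x in lebesgue. x \<in> cell P \<longrightarrow> N Q x \<le> b Q + N P x)"] by blast
    obtain F E where F: "disjoint_family_on E F"
      "\<And>Q. Q \<in> F \<Longrightarrow> E Q \<in> sets lebesgue \<and> E Q \<subseteq> cell Q \<and> emeasure lebesgue (cell Q) \<le> 2 * emeasure lebesgue (E Q)"
      "AE x in lebesgue. \<forall>Q\<in>R. x \<in> cell Q \<longrightarrow> N Q x \<le> (\<Sum>\<^sub>\<infinity>Q\<in>F. b Q * indicator (cell Q) x)"
      by (rule sparse_domination_of_step[where ch = ch and a = b and N = N and R = R]) (use ch R(1) in blast)+
    have T_cong: "AE x in lebesgue. T u x = T v x"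
      if "\<forall>i. u i \<in> Lspace r \<and> v i \<in> Lspace r \<and> (AE x in lebesgue. u i x = v i x)" for u v
      using ml that unfolding multilinear_operator_def by (elim conjE) (drule spec[of _ u], drule spec[of _ v], erule mp)
    have root: "AE x in lebesgue. \<forall>Q\<in>R. T f x = T (?g Q) x"
    proof (rule AE_ball_countable')
      fix Q assume Q: "Q \<in> R"
      show "AE x in lebesgue. T f x = T (?g Q) x"
      proof (rule T_cong, intro allI conjI)
        fix i
        show "f i \<in> Lspace r" using f by blast
        show "?g Q i \<in> Lspace r" using gL by (rule restr_Lspace) simp
        show "AE x in lebesgue. f i x = ?g Q i x"
          using g(2)[of i] AE_zero_outside_ess_supp[of "f i"]
          by eventually_elim (use supp[of i] R(3)[OF Q] in \<open>auto simp: restr_def\<close>)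
      qed
    qed auto
    show "\<exists>S. sparse_family S \<and> (AE x in lebesgue. ennreal (norm (T f x)) \<le>
        ennreal c * (weak_op_norm r T + hormander_const r K) * sparse_form r S f x)"
    proof (intro exI[of _ "dilate 5 ` F"] conjI)
      show "sparse_family (dilate 5 ` F)" using F(1,2) by (rule sparse_family_dilate)
      show "AE x in lebesgue. ennreal (norm (T f x)) \<le>
        ennreal c * (weak_op_norm r T + hormander_const r K) * sparse_form r (dilate 5 ` F) f x"
        using F(3) root
      proof eventually_elim
        case (elim x)
        obtain Q where Q: "Q \<in> R" "x \<in> cell Q" using R(2) by blast
        have "ennreal (norm (T f x)) = N Q x" using elim(2) Q by (simp add: N_def)
        also have "\<dots> \<le> (\<Sum>\<^sub>\<infinity>Q\<in>F. b Q * indicator (cell Q) x)" using elim(1) Q by blast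
        also have "\<dots> \<le> (\<Sum>\<^sub>\<infinity>Q\<in>F. ennreal (c * (a + h)) * ennreal (prod_avg r f Q * indicator (dilate 5 Q) x))"
        proof (rule infsum_mono_neutral)
          fix Q
          have "prod_avg r g Q = prod_avg r f Q"
            by (rule prod_avg_cong_AE[OF fm gm g(2), symmetric])
          moreover have "indicator (cell Q) x \<le> (indicator (dilate 5 Q) x :: ennreal)"
            using cell_subset_dilate[of 5 Q] by (auto simp: indicator_def)
          ultimately show "b Q * indicator (cell Q) x \<le> ennreal (c * (a + h)) * ennreal (prod_avg r f Q * indicator (dilate 5 Q) x)"
            using c0 a h prod_avg_nonneg[of r f Q] by (auto simp: b_def ennreal_mult indicator_def)
        qed (auto intro: nonneg_summable_on_complete)
        also have "\<dots> \<le> ennreal (c * (a + h)) * sparse_form r (dilate 5 ` F) f x"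
          unfolding sparse_form_dilate by (rule infsum_ennreal_cmult_le)
        also have "ennreal (c * (a + h)) = ennreal c * (weak_op_norm r T + hormander_const r K)"
          using c0 a h by (simp add: ennreal_mult)
        finally show ?case .
      qed
    qed
  qed
qed

end
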